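(* Let $a$ and $b$ be positive integers with $a$ even and $\gcd(a,b)=1$, and let $k\ge 1$ be an integer. Then the meander of type $\underbrace{a|a|\cdots|a}_{k}|b$ (that is, with top blocks consisting of $k$ blocks of size $a$ followed by one block of size $b$, and with a single bottom block of size $ka+b$) is Frobenius.
   Context: Meanders. Let $n$ be a positive integer and let $(a_1,\dots,a_\ell)$ and $(b_1,\dots,b_m)$ be two ordered partitions (compositions into positive parts) of $n$, called top and bottom. The meander of type $\frac{a_1|\cdots|a_\ell}{b_1|\cdots|b_m}$ is the planar (multi)graph on vertices $1,2,\dots,n$, placed on a line in this order, defined as follows. The top composition cuts $\{1,\dots,n\}$ into consecutive intervals (blocks) of sizes $a_1,\dots,a_\ell$; in each block, add a top edge joining its first vertex to its last, its second vertex to its second to last, and so on (the middle vertex of a block of odd size receives no top edge). Bottom edges are added in the same way using the bottom composition. A top edge and a bottom edge joining the same two vertices are regarded as two different edges (and form a cycle). Type $a_1|a_2|\cdots|a_\ell$ without a denominator means that there is exactly one bottom block, of size $n=a_1+\cdots+a_\ell$. Associated Lie algebra. Let $\mathbf{k}$ be a field of characteristic $0$ and $e_1,\dots,e_n$ the standard basis of $\mathbf{k}^n$. The seaweed Lie algebra associated with the meander is the Lie subalgebra of $\mathfrak{sl}_n(\mathbf{k})$ of all trace-zero matrices preserving the subspaces $V_i=\mathrm{span}(e_1,\dots,e_{a_1+\cdots+a_i})$ for all $i$ and $W_j=\mathrm{span}(e_{b_1+\cdots+b_j+1},\dots,e_n)$ for all $j$. Index. The index of a finite-dimensional Lie algebra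 $\mathfrak{g}$ is $\min_{f\in\mathfrak{g}^*}\dim\ker(B_f)$, where $B_f(x,y)=f([x,y])$; $\mathfrak{g}$ is Frobenius if its index is $0$. The index of a meander is the index of its associated seaweed subalgebra of $\mathfrak{sl}_n$, and the meander is called Frobenius if this index is $0$. By a theorem of Dergachev and Kirillov, this index equals $2C+P-1$, where $C$ is the number of connected components of the meander graph that are cycles and $P$ is the number of connected components that are paths (isolated vertices count as paths). Thus a meander is Frobenius if and only if its graph is a single path. *)

theory Defs
  imports "Jordan_Normal_Form.VS_Connect"
begin

text \<open>A finite-dimensional Lie algebra is given by its underlying vector space \<open>L\<close>, as a module
  record over \<^const>\<open>class_ring\<close>, together with a bracket \<open>br\<close>.\<close>

definition dual_space :: "('k::field, 'v, 'm) module_scheme \<Rightarrow> ('v \<Rightarrow> 'k) set" where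
  "dual_space L = {f.
     (\<forall>x\<in>carrier L. \<forall>y\<in>carrier L. f (x \<oplus>\<^bsub>L\<^esub> y) = f x + f y) \<and>
     (\<forall>c. \<forall>x\<in>carrier L. f (c \<odot>\<^bsub>L\<^esub> x) = c * f x)}"

definition bracket_form_kernel ::
  "('k::field, 'v, 'm) module_scheme \<Rightarrow> ('v \<Rightarrow> 'v \<Rightarrow> 'v) \<Rightarrow> ('v \<Rightarrow> 'k) \<Rightarrow> 'v set" where
  "bracket_form_kernel L br f = {x \<in> carrier L. \<forall>y\<in>carrier L. f (br x y) = 0}"

definition lie_index :: "('k::field, 'v, 'm) module_scheme \<Rightarrow> ('v \<Rightarrow> 'v \<Rightarrow> 'v) \<Rightarrow> nat" where
  "lie_index L br = (LEAST d. \<exists>f\<in>dual_space L.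
     d = vectorspace.dim class_ring (L\<lparr>carrier := bracket_form_kernel L br f\<rparr>))"

definition commutator :: "'k::ring_1 mat \<Rightarrow> 'k mat \<Rightarrow> 'k mat" where
  "commutator A B = A * B - B * A"

definition trace_mat :: "'k::comm_monoid_add mat \<Rightarrow> 'k" where
  "trace_mat A = (\<Sum>i<dim_row A. A $$ (i, i))"

text \<open>Vectors and matrices are indexed from \<open>0\<close>, so \<open>unit_vec n r\<close> is the basis vector
  \<open>e\<^sub>r\<^sub>+\<^sub>1\<close>.\<close>

definition coord_span :: "'k::field itself \<Rightarrow> nat \<Rightarrow> nat set \<Rightarrow> 'k vec set" where
  "coord_span ty n R = LinearCombinations.module.span class_ring (module_vec ty n) (unit_vec n ` R)"

definition preserves :: "'k::semiring_0 mat \<Rightarrow> 'k vec set \<Rightarrow> bool" where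
  "preserves A U \<longleftrightarrow> (\<forall>v\<in>U. A *\<^sub>v v \<in> U)"

text \<open>The type of a meander is a pair \<open>as\<close> (top), \<open>bs\<close> (bottom) of lists of positive numbers with
  equal sums. In the following, the subspace \<open>V\<^sub>i\<close> is spanned by an initial segment of the standard
  basis cut out by \<open>as\<close>, and \<open>W\<^sub>j\<close> by a final segment cut out by \<open>bs\<close>.\<close>

definition seaweed :: "'k::field itself \<Rightarrow> nat list \<Rightarrow> nat list \<Rightarrow> ('k, 'k mat) module" where
  "seaweed ty as bs = (let n = sum_list as in
     (module_mat ty n n)\<lparr>carrier := {A \<in> carrier_mat n n.
        trace_mat A = 0 \<and>
        (\<forall>i\<in>{1..length as}. preserves A (coord_span ty n {..<sum_list (take i as)})) \<and>
        (\<forall>j\<in>{1..length bs}. preserves A (coord_span ty n {sum_list (take j bs)..<n}))}\<rparr>)"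

definition meander_index :: "'k::field itself \<Rightarrow> nat list \<Rightarrow> nat list \<Rightarrow> nat" where
  "meander_index ty as bs = lie_index (seaweed ty as bs) commutator"

definition frobenius_meander :: "'k::field itself \<Rightarrow> nat list \<Rightarrow> nat list \<Rightarrow> bool" where
  "frobenius_meander ty as bs \<longleftrightarrow> meander_index ty as bs = 0"

end

theory Submission
  imports Defs "HOL-Number_Theory.Cong"
begin

text \<open>The index is \<open>0\<close> as soon as one functional has a bracket form with trivial kernel. For a meander
  whose graph is a single path such a functional is built recursively: if the first top block \<open>I\<close> is
  smaller than the first bottom block, the functional pairs \<open>I\<close> with the end of that bottom block,
  which identifies parts of a kernel element and leaves the same problem for the meander in which the
  corresponding edges are contracted; if it is larger, transpose. Contraction preserves being a
  path, and the recursion ends with a single vertex.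

  The graph of \<open>a|\<dots>|a|b\<close> is a path because \<open>n\<close> is odd, so the middle vertex has no bottom edge, and
  because it is connected: going along a bottom and then a top edge acts on residues modulo \<open>k a\<close> as
  the shift by \<open>b\<close> followed by a reversal of the blocks, \<open>gcd a b = 1\<close> makes all residues modulo \<open>a\<close>
  reachable, and the alternating sum of the residues modulo the even number \<open>a\<close> makes all blocks
  reachable.\<close>

subsection \<open>Rigid functionals and contraction\<close>

text \<open>Matrices are functions with an explicit finite index set, so that contraction can remove
  indices without any renumbering.\<close>

definition commutator_entry :: "'a set \<Rightarrow> ('a \<Rightarrow> 'a \<Rightarrow> 'k::field) \<Rightarrow> ('a \<Rightarrow> 'a \<Rightarrow> 'k) \<Rightarrow> 'a \<Rightarrow> 'a \<Rightarrow> 'k" where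
  "commutator_entry S F A i j = (\<Sum>x\<in>S. F i x * A x j) - (\<Sum>x\<in>S. A i x * F x j)"

text \<open>\<open>R i j\<close> says that position \<open>(i, j)\<close> may be nonzero in the Lie algebra, and \<open>F\<close> encodes the
  functional \<open>A \<mapsto> \<Sum> F\<^sub>i\<^sub>j A\<^sub>j\<^sub>i\<close>; only positions of \<open>F\<close> transposed to allowed ones matter. Rigidity
  then says that the kernel of the bracket form consists of scalar matrices only.\<close>

definition rigid :: "'a set \<Rightarrow> ('a \<Rightarrow> 'a \<Rightarrow> bool) \<Rightarrow> ('a \<Rightarrow> 'a \<Rightarrow> 'k::field) \<Rightarrow> bool" where
  "rigid S R F \<longleftrightarrow>
     (\<forall>i\<in>S. \<forall>j\<in>S. \<not> R j i \<longrightarrow> F i j = 0) \<and>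
     (\<forall>A. (\<forall>i\<in>S. \<forall>j\<in>S. \<not> R i j \<longrightarrow> A i j = 0) \<longrightarrow>
          (\<forall>i\<in>S. \<forall>j\<in>S. R j i \<longrightarrow> commutator_entry S F A i j = 0) \<longrightarrow>
          (\<exists>c. \<forall>i\<in>S. \<forall>j\<in>S. A i j = (if i = j then c else 0)))"

lemma rigid_support:
  "rigid S R F \<Longrightarrow> i \<in> S \<Longrightarrow> j \<in> S \<Longrightarrow> \<not> R j i \<Longrightarrow> F i j = 0"
  by (simp add: rigid_def)

lemma rigid_scalar:
  assumes "rigid S R F"
    and "\<And>i j. i \<in> S \<Longrightarrow> j \<in> S \<Longrightarrow> \<not> R i j \<Longrightarrow> A i j = 0"
    and "\<And>i j. i \<in> S \<Longrightarrow> j \<in> S \<Longrightarrow> R j i \<Longrightarrow> commutator_entry S F A i j = 0"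
  shows "\<exists>c. \<forall>i\<in>S. \<forall>j\<in>S. A i j = (if i = j then c else 0)"
  using assms(1)[unfolded rigid_def, THEN conjunct2, THEN spec[of _ A]] assms(2,3) by simp

text \<open>Transposition turns a commutator into the negative of the commutator of the transposes.
  This is what allows top and bottom to be exchanged.\<close>

lemma rigid_transpose:
  fixes F :: "'a \<Rightarrow> 'a \<Rightarrow> 'k::field"
  assumes "rigid S R F"
  shows "rigid S (\<lambda>i j. R j i) (\<lambda>i j. F j i)"
  unfolding rigid_def
proof (intro conjI allI impI)
  show "\<forall>i\<in>S. \<forall>j\<in>S. \<not> R i j \<longrightarrow> F j i = 0"
    using assms by (auto simp: rigid_def)
next
  fix A :: "'a \<Rightarrow> 'a \<Rightarrow> 'k"
  assume supp: "\<forall>i\<in>S. \<forall>j\<in>S. \<not> R j i \<longrightarrow> A i j = 0"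
    and comm: "\<forall>i\<in>S. \<forall>j\<in>S. R i j \<longrightarrow> commutator_entry S (\<lambda>i j. F j i) A i j = 0"
  let ?A = "\<lambda>i j. A j i"
  have "commutator_entry S F ?A i j = - commutator_entry S (\<lambda>i j. F j i) A j i" for i j
    by (simp add: commutator_entry_def mult.commute)
  then have "\<exists>c. \<forall>i\<in>S. \<forall>j\<in>S. ?A i j = (if i = j then c else 0)"
    using assms supp comm unfolding rigid_def by simp
  then show "\<exists>c. \<forall>i\<in>S. \<forall>j\<in>S. A i j = (if i = j then c else 0)"
    by metis
qed

lemma rigid_singleton: "R x x \<Longrightarrow> rigid {x} R F"
  by (auto simp: rigid_def)

lemma rigid_cong:
  assumes "\<And>i j. i \<in> S \<Longrightarrow> j \<in> S \<Longrightarrow> R i j \<longleftrightarrow> R' i j"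
  shows "rigid S R F \<longleftrightarrow> rigid S R' F"
  using assms unfolding rigid_def by simp

text \<open>Pairing \<open>I\<close> with \<open>\<phi> ` I\<close> in the functional forces a kernel element to act on \<open>I\<close> as it does
  on \<open>\<phi> ` I\<close>, and to leave \<open>\<phi> ` I\<close> invariant inside \<open>M\<close>. So \<open>I\<close> can be dropped at the price of
  forbidding the positions \<open>(M - \<phi> ` I) \<times> \<phi> ` I\<close>.\<close>

lemma rigid_absorb_injective:
  fixes F' :: "'a \<Rightarrow> 'a \<Rightarrow> 'k::field"
  assumes fin: "finite I" "finite W" and disj: "I \<inter> W = {}"
    and \<phi>: "inj_on \<phi> I" "\<phi> ` I \<subseteq> M" and MW: "M \<subseteq> W"
    and RII: "\<And>i j. i \<in> I \<Longrightarrow> j \<in> I \<Longrightarrow> R i j"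
    and RWI: "\<And>w i. w \<in> W \<Longrightarrow> i \<in> I \<Longrightarrow> \<not> R w i"
    and RIW: "\<And>i w. i \<in> I \<Longrightarrow> w \<in> W \<Longrightarrow> R i w \<longleftrightarrow> w \<in> M"
    and RMU: "\<And>w i. w \<in> M - \<phi> ` I \<Longrightarrow> i \<in> I \<Longrightarrow> R w (\<phi> i)"
    and rig: "rigid W (\<lambda>r c. R r c \<and> \<not> (r \<in> M - \<phi> ` I \<and> c \<in> \<phi> ` I)) F'"
  shows "\<exists>F :: 'a \<Rightarrow> 'a \<Rightarrow> 'k. rigid (I \<union> W) R F"
proof -
  let ?U = "\<phi> ` I"
  \<comment> \<open>The column of \<open>F\<close> at \<open>j\<close> in \<open>I\<close> is the
    unit vector at \<open>\<phi> j\<close>. So \<open>A F\<close> carries column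
    \<open>\<phi> j\<close> of \<open>A\<close> to column \<open>j\<close>, and in
    \<open>F A\<close> row \<open>c\<close> of \<open>A\<close> appears in row
    \<open>\<phi> c\<close>.\<close>
  define F where "F i j = (if i \<in> W \<and> j \<in> W then F' i j else if j \<in> I \<and> i = \<phi> j then 1 else 0)" for i j
  have \<phi>W: "\<phi> i \<in> W" "\<phi> i \<in> M" if "i \<in> I" for i
    using that \<phi>(2) MW by auto
  have notW: "i \<notin> W" if "i \<in> I" for i
    using that disj by auto
  have notI: "i \<notin> I" if "i \<in> W" for i
    using that disj by auto
  have suppF': "F' i j = 0" if "i \<in> W" "j \<in> W" "\<not> R j i" for i j
    using rigid_support[OF rig] that by blast
  have row: "F w i = (if w = \<phi> i then 1 else 0)" if "i \<in> I" for w i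
    using that notW by (auto simp: F_def)
  have row0: "F i x = 0" if "i \<in> I" for i x
    using that notW \<phi>W by (auto simp: F_def)
  have colW: "F w x = F' w x" if "w \<in> W" "x \<in> W" for w x
    using that by (simp add: F_def)
  have split: "(\<Sum>x\<in>I \<union> W. g x) = (\<Sum>x\<in>I. g x) + (\<Sum>x\<in>W. g x)" for g :: "'a \<Rightarrow> 'k"
    using fin disj by (rule sum.union_disjoint)
  have suppF: "F i j = 0" if ij: "i \<in> I \<union> W" "j \<in> I \<union> W" "\<not> R j i" for i j
  proof (cases "i \<in> W \<and> j \<in> W")
    case True
    then show ?thesis using suppF' ij by (simp add: F_def)
  next
    case False
    then show ?thesis using ij RIW \<phi>W by (auto simp: F_def)
  qed
  have "rigid (I \<union> W) R F"
    unfolding rigid_def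
  proof (intro conjI allI impI)
    show "\<forall>i\<in>I \<union> W. \<forall>j\<in>I \<union> W. \<not> R j i \<longrightarrow> F i j = 0"
      using suppF by blast
  next
    fix A :: "'a \<Rightarrow> 'a \<Rightarrow> 'k"
    assume supp: "\<forall>i\<in>I \<union> W. \<forall>j\<in>I \<union> W. \<not> R i j \<longrightarrow> A i j = 0"
      and comm: "\<forall>i\<in>I \<union> W. \<forall>j\<in>I \<union> W. R j i \<longrightarrow> commutator_entry (I \<union> W) F A i j = 0"
    have AWI: "A w i = 0" if "w \<in> W" "i \<in> I" for w i
      using supp RWI that by blast
    have sumF: "(\<Sum>x\<in>I. F (\<phi> c) x * A x j) = A c j" if "c \<in> I" for c j
    proof -
      have "(\<Sum>x\<in>I. F (\<phi> c) x * A x j) = (\<Sum>x\<in>I. if x = c then A x j else 0)"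
        using that \<phi>(1) by (intro sum.cong) (auto simp: row inj_on_eq_iff)
      then show ?thesis using that fin by simp
    qed
    have sumF0: "(\<Sum>x\<in>I. F w x * A x j) = 0" if "w \<notin> ?U" for w j
      using that by (intro sum.neutral) (auto simp: row)
    have AF: "(\<Sum>x\<in>I \<union> W. A i x * F x j) = A i (\<phi> j)" if "j \<in> I" for i j
    proof -
      have "(\<Sum>x\<in>I \<union> W. A i x * F x j) = (\<Sum>x\<in>I \<union> W. if x = \<phi> j then A i x else 0)"
        using that by (intro sum.cong) (auto simp: row)
      then show ?thesis using that fin \<phi>W by simp
    qed
    have AFW: "(\<Sum>x\<in>I \<union> W. A i x * F x j) = (\<Sum>x\<in>W. A i x * F' x j)" if "j \<in> W" for i j
      unfolding split using that by (simp add: row0 colW)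
    have MI: "commutator_entry (I \<union> W) F A w i = (\<Sum>x\<in>I. F w x * A x i) - A w (\<phi> i)"
      if "w \<in> M" "i \<in> I" for w i
      unfolding commutator_entry_def AF[OF \<open>i \<in> I\<close>] split using that by (simp add: AWI)
    have MI0: "commutator_entry (I \<union> W) F A w i = 0" if "w \<in> M" "i \<in> I" for w i
      using that comm RIW MW by blast
    have A\<phi>: "A (\<phi> c) (\<phi> i) = A c i" if "c \<in> I" "i \<in> I" for c i
      using MI[of "\<phi> c" i] MI0[of "\<phi> c" i] that \<phi>W sumF by simp
    have AMU: "A w (\<phi> i) = 0" if "w \<in> M - ?U" "i \<in> I" for w i
      using MI[of w i] MI0[of w i] that sumF0[of w] by simp
    have AIU: "A i (\<phi> j) = 0" if "i \<in> I" "j \<in> I" for i j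
    proof -
      have "commutator_entry (I \<union> W) F A i j = - A i (\<phi> j)"
        unfolding commutator_entry_def AF[OF \<open>j \<in> I\<close>] using that by (simp add: row0)
      moreover have "commutator_entry (I \<union> W) F A i j = 0"
        using that comm RII by blast
      ultimately show ?thesis by simp
    qed
    have WW: "commutator_entry (I \<union> W) F A s t = (\<Sum>x\<in>I. F s x * A x t) + commutator_entry W F' A s t"
      if "s \<in> W" "t \<in> W" for s t
      unfolding commutator_entry_def AFW[OF \<open>t \<in> W\<close>] split using that by (simp add: colW)
    have "\<exists>c. \<forall>i\<in>W. \<forall>j\<in>W. A i j = (if i = j then c else 0)"
    proof (rule rigid_scalar[OF rig])
      show "A i j = 0" if "i \<in> W" "j \<in> W" "\<not> (R i j \<and> \<not> (i \<in> M - ?U \<and> j \<in> ?U))" for i j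
        using that supp AMU by blast
    next
      show "commutator_entry W F' A s t = 0"
        if st: "s \<in> W" "t \<in> W" "R t s \<and> \<not> (t \<in> M - ?U \<and> s \<in> ?U)" for s t
      proof -
        \<comment> \<open>For \<open>s = \<phi> c\<close> the sum is \<open>A c t\<close>. It
          vanishes for \<open>t\<close> in the image of \<open>\<phi>\<close> by \<open>AIU\<close>
          and for \<open>t\<close> outside \<open>M\<close> by the support condition; the remaining
          \<open>t\<close> are exactly those excluded by the contracted relation.\<close>
        have "(\<Sum>x\<in>I. F s x * A x t) = 0"
        proof (cases "s \<in> ?U")
          case True
          then obtain c where c: "c \<in> I" "s = \<phi> c" by blast
          have "A c t = 0"
            using st True c AIU supp RIW by blast
          then show ?thesis using c sumF by simp
        next
          case False
          then show ?thesis by (rule sumF0)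
        qed
        moreover have "commutator_entry (I \<union> W) F A s t = 0"
          using st comm by blast
        ultimately show ?thesis using WW st by simp
      qed
    qed
    then obtain c where c: "\<And>i j. i \<in> W \<Longrightarrow> j \<in> W \<Longrightarrow> A i j = (if i = j then c else 0)"
      by blast
    have cII: "A i j = (if i = j then c else 0)" if "i \<in> I" "j \<in> I" for i j
      using A\<phi>[of i j] c[of "\<phi> i" "\<phi> j"] that \<phi>W \<phi>(1) by (auto simp: inj_on_eq_iff)
    \<comment> \<open>A scalar matrix commutes with \<open>F'\<close> everywhere, also at the
      positions dropped from the contracted relation. The original equations at those positions then
      reduce to \<open>A i w = 0\<close>.\<close>
    have scal: "commutator_entry W F' A s t = 0" if "s \<in> W" "t \<in> W" for s t
    proof -
      have "(\<Sum>x\<in>W. F' s x * A x t) = (\<Sum>x\<in>W. if x = t then F' s t * c else 0)"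
        using that by (intro sum.cong) (simp_all add: c)
      moreover have "(\<Sum>x\<in>W. A s x * F' x t) = (\<Sum>x\<in>W. if x = s then F' s t * c else 0)"
        using that by (intro sum.cong) (simp_all add: c)
      ultimately show ?thesis using that fin by (simp add: commutator_entry_def)
    qed
    have cIW: "A i w = 0" if iw: "i \<in> I" "w \<in> W" for i w
    proof -
      consider "w \<notin> M" | "w \<in> ?U" | "w \<in> M - ?U" by blast
      then show ?thesis
      proof cases
        case 1
        then show ?thesis using iw supp RIW by blast
      next
        case 2
        then show ?thesis using iw AIU by blast
      next
        case 3
        then have "commutator_entry (I \<union> W) F A (\<phi> i) w = 0"
          using comm RMU iw \<phi>W by blast
        then show ?thesis using WW[of "\<phi> i" w] scal[of "\<phi> i" w] sumF iw \<phi>W by simp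
      qed
    qed
    have "\<forall>i\<in>I \<union> W. \<forall>j\<in>I \<union> W. A i j = (if i = j then c else 0)"
      using c cII cIW AWI disj by (metis UnE disjoint_iff)
    then show "\<exists>c. \<forall>i\<in>I \<union> W. \<forall>j\<in>I \<union> W. A i j = (if i = j then c else 0)" ..
  qed
  then show ?thesis by blast
qed

text \<open>Here \<open>M\<close> is too small to receive all of \<open>I = K \<union> C\<close>. A kernel element leaves \<open>K\<close> invariant, the
  quotient by \<open>K\<close> is identified with \<open>M\<close>, and the block \<open>K \<times> C\<close> survives as the block \<open>K \<times> M\<close>.\<close>

lemma rigid_absorb_surjective:
  fixes F' :: "'a \<Rightarrow> 'a \<Rightarrow> 'k::field"
  assumes fin: "finite K" "finite C" "finite W"
    and disj: "K \<inter> C = {}" "(K \<union> C) \<inter> W = {}"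
    and \<phi>: "bij_betw \<phi> C M" and MW: "M \<subseteq> W"
    and RII: "\<And>i j. i \<in> K \<union> C \<Longrightarrow> j \<in> K \<union> C \<Longrightarrow> R i j"
    and RWI: "\<And>w i. w \<in> W \<Longrightarrow> i \<in> K \<union> C \<Longrightarrow> \<not> R w i"
    and RIW: "\<And>i w. i \<in> K \<union> C \<Longrightarrow> w \<in> W \<Longrightarrow> R i w \<longleftrightarrow> w \<in> M"
    and rig: "rigid (K \<union> W) R F'"
  shows "\<exists>F :: 'a \<Rightarrow> 'a \<Rightarrow> 'k. rigid (K \<union> C \<union> W) R F"
proof -
  let ?S = "K \<union> C \<union> W"
  \<comment> \<open>The entries of \<open>F'\<close> on \<open>M\<close> x \<open>K\<close> move to
    \<open>C\<close> x \<open>K\<close> along \<open>\<phi>\<close>, which leaves \<open>W\<close> x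
    \<open>K\<close> empty; the matching of \<open>C\<close> with \<open>M\<close> is placed in
    \<open>W\<close> x \<open>C\<close>.\<close>
  define F where "F i j = (if i \<in> W \<and> j \<in> K then 0
      else if i \<in> K \<union> W \<and> j \<in> K \<union> W then F' i j
      else if i \<in> C \<and> j \<in> K then F' (\<phi> i) j
      else if j \<in> C \<and> i = \<phi> j then 1 else 0)" for i j
  define \<psi> where "\<psi> = inv_into C \<phi>"
  have inj: "inj_on \<phi> C" and im: "\<phi> ` C = M"
    using \<phi> by (auto simp: bij_betw_def)
  have \<psi>\<phi> [simp]: "\<psi> (\<phi> c) = c" if "c \<in> C" for c
    using inj that by (simp add: \<psi>_def)
  have \<phi>W: "\<phi> c \<in> W" "\<phi> c \<in> M" if "c \<in> C" for c
    using that im MW by auto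
  have notin: "k \<in> K \<Longrightarrow> k \<notin> C" "k \<in> K \<Longrightarrow> k \<notin> W" "k \<in> C \<Longrightarrow> k \<notin> W" for k
    using disj by auto
  have split: "(\<Sum>x\<in>?S. g x) = (\<Sum>x\<in>K. g x) + (\<Sum>x\<in>C. g x) + (\<Sum>x\<in>W. g x)" for g :: "'a \<Rightarrow> 'k"
    using fin disj by (simp add: sum.union_disjoint)
  have splitKW: "(\<Sum>x\<in>K \<union> W. g x) = (\<Sum>x\<in>K. g x) + (\<Sum>x\<in>W. g x)" for g :: "'a \<Rightarrow> 'k"
    using fin disj by (intro sum.union_disjoint) auto
  have F'WK: "F' w k = 0" if "w \<in> W - M" "k \<in> K" for w k
    using rigid_support[OF rig, of w k] that RIW by blast
  have F'KW: "F' k w = 0" if "w \<in> W" "k \<in> K" for w k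
    using rigid_support[OF rig, of k w] that RWI by blast
  have FWK: "F w k = 0" if "w \<in> W" "k \<in> K" for w k
    using that by (simp add: F_def)
  have FKK: "F k k' = F' k k'" if "k \<in> K" "k' \<in> K" for k k'
    using that notin by (auto simp: F_def)
  have FKC: "F k c = 0" if "k \<in> K" "c \<in> C" for k c
    using that notin \<phi>W by (auto simp: F_def)
  have FCC: "F c' c = 0" if "c' \<in> C" "c \<in> C" for c c'
    using that notin \<phi>W by (auto simp: F_def)
  have FCK: "F c k = F' (\<phi> c) k" if "c \<in> C" "k \<in> K" for c k
    using that notin by (auto simp: F_def)
  have FWC: "F w c = (if w = \<phi> c then 1 else 0)" if "w \<in> W" "c \<in> C" for w c
    using that notin by (auto simp: F_def)
  have FWW: "F s t = F' s t" if "s \<in> W" "t \<in> W" for s t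
    using that notin by (auto simp: F_def)
  have FIW: "F i w = 0" if "i \<in> K \<union> C" "w \<in> W" for i w
    using that notin F'KW \<phi>W by (auto simp: F_def)
  have suppF: "F i j = 0" if ij: "i \<in> ?S" "j \<in> ?S" "\<not> R j i" for i j
  proof -
    consider "i \<in> K \<union> C" "j \<in> K \<union> C" | "i \<in> K \<union> C" "j \<in> W" | "i \<in> W" "j \<in> K" | "i \<in> W" "j \<in> C" | "i \<in> W" "j \<in> W"
      using ij by blast
    then show ?thesis
    proof cases
      case 1
      then show ?thesis using ij RII by blast
    next
      case 4
      then show ?thesis using ij RIW[of j i] FWC \<phi>W by auto
    next
      case 5
      then show ?thesis using ij rigid_support[OF rig, of i j] FWW by simp
    qed (simp_all add: FIW FWK)
  qed
  have "rigid ?S R F"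
    unfolding rigid_def
  proof (intro conjI allI impI)
    show "\<forall>i\<in>?S. \<forall>j\<in>?S. \<not> R j i \<longrightarrow> F i j = 0"
      using suppF by blast
  next
    fix A :: "'a \<Rightarrow> 'a \<Rightarrow> 'k"
    assume supp: "\<forall>i\<in>?S. \<forall>j\<in>?S. \<not> R i j \<longrightarrow> A i j = 0"
      and comm: "\<forall>i\<in>?S. \<forall>j\<in>?S. R j i \<longrightarrow> commutator_entry ?S F A i j = 0"
    have AWI: "A w i = 0" if "w \<in> W" "i \<in> K \<union> C" for w i
      using supp RWI that by blast
    have AIW: "A i w = 0" if "w \<in> W" "w \<notin> M" "i \<in> K \<union> C" for w i
      using supp RIW that by blast
    have sumF: "(\<Sum>x\<in>C. F (\<phi> c) x * A x j) = A c j" if "c \<in> C" for c j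
    proof -
      have "(\<Sum>x\<in>C. F (\<phi> c) x * A x j) = (\<Sum>x\<in>C. if x = c then A x j else 0)"
        using that inj \<phi>W by (intro sum.cong) (auto simp: FWC inj_on_eq_iff)
      then show ?thesis using that fin by simp
    qed
    have sumF0: "(\<Sum>x\<in>C. F w x * A x j) = 0" if "w \<in> W" "w \<notin> M" for w j
      using that by (intro sum.neutral) (auto simp: FWC im[symmetric])
    have AFC: "(\<Sum>x\<in>?S. A i x * F x c) = A i (\<phi> c)" if "c \<in> C" for i c
    proof -
      have "(\<Sum>x\<in>W. A i x * F x c) = (\<Sum>x\<in>W. if x = \<phi> c then A i x else 0)"
        using that by (intro sum.cong) (auto simp: FWC)
      also have "\<dots> = A i (\<phi> c)"
        using that fin \<phi>W by simp
      finally show ?thesis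
        unfolding split using that by (simp add: FKC FCC)
    qed
    have AFK: "(\<Sum>x\<in>?S. A i x * F x k) = (\<Sum>x\<in>K. A i x * F' x k) + (\<Sum>c\<in>C. A i c * F' (\<phi> c) k)"
      if "k \<in> K" for i k
      unfolding split using that by (simp add: FKK FCK FWK)
    have AFW: "(\<Sum>x\<in>?S. A i x * F x t) = (\<Sum>x\<in>W. A i x * F' x t)" if "t \<in> W" for i t
      unfolding split using that by (simp add: FIW FWW)
    have FAK: "(\<Sum>x\<in>?S. F k x * A x j) = (\<Sum>x\<in>K. F' k x * A x j)" if "k \<in> K" for k j
      unfolding split using that by (simp add: FKK FKC FIW)
    have FAC: "(\<Sum>x\<in>?S. F c x * A x j) = (\<Sum>x\<in>K. F' (\<phi> c) x * A x j)" if "c \<in> C" for c j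
      unfolding split using that by (simp add: FCK FCC FIW)
    have FAW: "(\<Sum>x\<in>?S. F s x * A x j) = (\<Sum>x\<in>C. F s x * A x j) + (\<Sum>x\<in>W. F' s x * A x j)"
      if "s \<in> W" for s j
      unfolding split using that by (simp add: FWK FWW)
    note entry = commutator_entry_def

    have MI0: "commutator_entry ?S F A (\<phi> c) i = 0" if "c \<in> C" "i \<in> K \<union> C" for c i
      using that comm RIW[of i "\<phi> c"] \<phi>W[of c] by blast
    have II0: "commutator_entry ?S F A i j = 0" if "i \<in> K \<union> C" "j \<in> K \<union> C" for i j
      using that comm RII by blast
    \<comment> \<open>The equations in row \<open>\<phi> c\<close> isolate row \<open>c\<close> of
      \<open>A\<close>: in the columns \<open>K\<close> nothing else survives, and in the columns
      \<open>C\<close> the other term is the entry of \<open>A\<close> on \<open>M\<close> x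
      \<open>M\<close>.\<close>
    have ACK: "A c k = 0" if "c \<in> C" "k \<in> K" for c k
      using MI0[of c k] that \<phi>W sumF
      by (simp add: entry FAW AFK AWI)
    have A\<phi>: "A (\<phi> c') (\<phi> c) = A c' c" if "c' \<in> C" "c \<in> C" for c c'
      using MI0[of c' c] that \<phi>W sumF by (simp add: entry FAW AFC AWI)
    \<comment> \<open>The columns of \<open>A\<close> in \<open>M\<close> are, in the rows of
      \<open>K\<close> and \<open>C\<close>, determined by the block \<open>K\<close> x
      \<open>C\<close>. Hence the positions \<open>K\<close> x \<open>M\<close> are free to hold
      that block after the contraction.\<close>
    have AK\<phi>: "A k (\<phi> c) = (\<Sum>x\<in>K. F' k x * A x c)" if "k \<in> K" "c \<in> C" for k c
      using II0[of k c] that by (simp add: entry FAK AFC)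
    have AC\<phi>: "A c' (\<phi> c) = (\<Sum>x\<in>K. F' (\<phi> c') x * A x c)" if "c' \<in> C" "c \<in> C" for c' c
      using II0[of c' c] that by (simp add: entry FAC AFC)

    \<comment> \<open>the matrix after the contraction\<close>
    define B where "B i j = (if i \<in> K \<and> j \<in> M then A i (\<psi> j) else A i j)" for i j
    have BK\<phi>: "B k (\<phi> c) = A k c" if "k \<in> K" "c \<in> C" for k c
      using that \<phi>W by (simp add: B_def)
    have BKK: "B k k' = A k k'" if "k' \<in> K" for k k'
      using that MW notin by (auto simp: B_def)
    have BW: "B w j = A w j" if "w \<in> W" for w j
      using that notin by (auto simp: B_def)
    have BKW: "B k w = 0" if "k \<in> K" "w \<in> W" "w \<notin> M" for k w
      using that AIW by (auto simp: B_def)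
    have sumM: "(\<Sum>x\<in>W. g x) = (\<Sum>c\<in>C. g (\<phi> c))" if "\<And>x. x \<in> W \<Longrightarrow> x \<notin> M \<Longrightarrow> g x = 0" for g :: "'a \<Rightarrow> 'k"
    proof -
      have "(\<Sum>x\<in>W. g x) = (\<Sum>x\<in>M. g x)"
        using that MW fin by (intro sum.mono_neutral_right) auto
      then show ?thesis
        using sum.reindex_bij_betw[OF \<phi>, of g] by simp
    qed
    have "\<exists>c. \<forall>i\<in>K \<union> W. \<forall>j\<in>K \<union> W. B i j = (if i = j then c else 0)"
    proof (rule rigid_scalar[OF rig])
      show "B i j = 0" if "i \<in> K \<union> W" "j \<in> K \<union> W" "\<not> R i j" for i j
      proof -
        have "\<not> (i \<in> K \<and> j \<in> M)"
          using that RIW MW by blast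
        then have "B i j = A i j" by (auto simp: B_def)
        then show ?thesis using that supp by auto
      qed
    next
      fix i j
      assume ij: "i \<in> K \<union> W" "j \<in> K \<union> W" "R j i"
      then consider "i \<in> K" "j \<in> K" | c where "c \<in> C" "i = \<phi> c" "j \<in> K" | "i \<in> W" "j \<in> W"
        using RWI RIW im by blast
      then show "commutator_entry (K \<union> W) F' B i j = 0"
      proof cases
        case 1
        have "(\<Sum>x\<in>W. B i x * F' x j) = (\<Sum>c\<in>C. A i c * F' (\<phi> c) j)"
          using 1 BKW by (subst sumM) (auto simp: BK\<phi>)
        then show ?thesis
          using II0[of i j] 1 by (simp add: entry FAK AFK splitKW F'KW BKK)
      next
        case 2
        have "(\<Sum>x\<in>W. B i x * F' x j) = (\<Sum>c'\<in>C. A c c' * F' (\<phi> c') j)"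
          using 2 F'WK by (subst sumM) (auto simp: BW \<phi>W A\<phi>)
        then show ?thesis
          using II0[of c j] 2 by (simp add: entry FAC AFK splitKW BKK BW AWI ACK \<phi>W)
      next
        case 3
        \<comment> \<open>The term through \<open>C\<close> in the large commutator must become the
          term through \<open>K\<close> in the small one. For \<open>i = \<phi> c\<close> and
          \<open>j = \<phi> d\<close> this is the formula \<open>AC\<phi>\<close>; otherwise both
          sides vanish.\<close>
        have "(\<Sum>x\<in>C. F i x * A x j) = (\<Sum>x\<in>K. F' i x * B x j)"
        proof (cases "i \<in> M")
          case True
          then obtain c where c: "c \<in> C" "i = \<phi> c" using im by blast
          show ?thesis
          proof (cases "j \<in> M")
            case True
            then obtain d where d: "d \<in> C" "j = \<phi> d" using im by blast
            have "(\<Sum>x\<in>C. F i x * A x j) = A c j"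
              unfolding c(2) using c(1) by (rule sumF)
            also have "\<dots> = (\<Sum>x\<in>K. F' i x * B x j)"
              unfolding c(2) d(2) AC\<phi>[OF c(1) d(1)] using d(1) by (simp add: BK\<phi>)
            finally show ?thesis .
          next
            case False
            then show ?thesis using c 3 by (simp add: sumF AIW BKW)
          qed
        next
          case False
          then show ?thesis using 3 sumF0[of i j] F'WK[of i] by simp
        qed
        moreover have "commutator_entry ?S F A i j = 0"
          using 3 ij comm by blast
        ultimately show ?thesis
          using 3 by (simp add: entry FAW AFW splitKW BW AWI)
      qed
    qed
    then obtain c where c: "\<And>i j. i \<in> K \<union> W \<Longrightarrow> j \<in> K \<union> W \<Longrightarrow> B i j = (if i = j then c else 0)"
      by blast
    have "\<forall>i\<in>?S. \<forall>j\<in>?S. A i j = (if i = j then c else 0)"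
    proof (intro ballI)
      fix i j
      assume ij: "i \<in> ?S" "j \<in> ?S"
      have KC: "A k d = 0" if "k \<in> K" "d \<in> C" for k d
        using c[of k "\<phi> d"] BK\<phi>[of k d] that \<phi>W notin by auto
      have IW: "A i w = 0" if iw: "i \<in> K \<union> C" "w \<in> W" for i w
      proof (cases "w \<in> M")
        case True
        then obtain d where "d \<in> C" "w = \<phi> d" using im by blast
        then show ?thesis using iw KC by (auto simp: AK\<phi> AC\<phi>)
      next
        case False
        then show ?thesis using AIW iw by blast
      qed
      consider "i \<in> K" "j \<in> K" | "i \<in> W" "j \<in> W" | "i \<in> C" "j \<in> C" | "i \<in> K" "j \<in> C"
        | "i \<in> C" "j \<in> K" | "i \<in> K \<union> C" "j \<in> W" | "i \<in> W" "j \<in> K \<union> C"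
        using ij by blast
      then show "A i j = (if i = j then c else 0)"
      proof cases
        case 1
        then show ?thesis using c[of i j] BKK[of j i] by simp
      next
        case 2
        then show ?thesis using c[of i j] BW[of i j] by simp
      next
        case 3
        then show ?thesis
          using A\<phi>[of i j] c[of "\<phi> i" "\<phi> j"] BW[of "\<phi> i"] \<phi>W inj by (auto simp: inj_on_eq_iff)
      next
        case 4
        then show ?thesis using KC notin by auto
      next
        case 5
        then show ?thesis using ACK notin by auto
      next
        case 6
        then show ?thesis using IW notin by auto
      next
        case 7
        then show ?thesis using AWI notin by auto
      qed
    qed
    then show "\<exists>c. \<forall>i\<in>?S. \<forall>j\<in>?S. A i j = (if i = j then c else 0)" ..
  qed
  then show ?thesis by blast
qed

subsection \<open>Meanders that are a single path\<close>

text \<open>The blocks of a composition of \<open>{s..<n}\<close> are the classes of a monotone rank function \<open>t\<close>; a map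
  that preserves the classes and keeps \<open>T x + x\<close> constant on each of them must reverse them, so \<open>T\<close>
  sends a vertex to the other end of its edge and fixes the middle vertices.\<close>

definition reverses_classes :: "nat \<Rightarrow> nat \<Rightarrow> (nat \<Rightarrow> nat) \<Rightarrow> (nat \<Rightarrow> nat) \<Rightarrow> bool" where
  "reverses_classes s n t T \<longleftrightarrow>
     (\<forall>x\<in>{s..<n}. \<forall>y\<in>{s..<n}. x \<le> y \<longrightarrow> t x \<le> t y) \<and>
     (\<forall>x\<in>{s..<n}. T x \<in> {s..<n} \<and> t (T x) = t x) \<and>
     (\<forall>x\<in>{s..<n}. \<forall>y\<in>{s..<n}. t x = t y \<longrightarrow> T x + x = T y + y)"

text \<open>For involutions this is connectedness of the graph with edges \<open>x - T x\<close> and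
  \<open>x - B x\<close>. Stating it through closed predicates avoids walks and lets it be used as
  an induction rule.\<close>

definition jointly_transitive :: "'a set \<Rightarrow> ('a \<Rightarrow> 'a) \<Rightarrow> ('a \<Rightarrow> 'a) \<Rightarrow> bool" where
  "jointly_transitive S T B \<longleftrightarrow>
     (\<forall>Q. (\<exists>x\<in>S. Q x) \<longrightarrow> (\<forall>x\<in>S. Q x \<longrightarrow> Q (T x) \<and> Q (B x)) \<longrightarrow> (\<forall>x\<in>S. Q x))"

lemma jointly_transitive_commute: "jointly_transitive S T B \<longleftrightarrow> jointly_transitive S B T"
  unfolding jointly_transitive_def by (simp add: conj_commute)

text \<open>Contracting the edges \<open>x - B x\<close> for \<open>x \<in> I\<close>: the edges of \<open>T\<close> on \<open>I\<close> turn into edges of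
  \<open>B' = B T B\<close> on \<open>B ` I\<close>.\<close>

lemma jointly_transitive_contract:
  assumes tr: "jointly_transitive S T B" and sub: "S' \<subseteq> S" "S - I \<subseteq> S'"
    and TI: "\<And>x. x \<in> I \<Longrightarrow> T x \<in> I" "\<And>x. x \<in> S - I \<Longrightarrow> T x \<in> S - I"
    and BB: "\<And>x. x \<in> S \<Longrightarrow> B x \<in> S" "\<And>x. x \<in> S \<Longrightarrow> B (B x) = x"
    and I: "I \<subseteq> S" "\<And>x. x \<in> I \<Longrightarrow> B x \<in> S'"
    and K: "\<And>x. x \<in> S' \<inter> I \<Longrightarrow> B x \<in> I" "\<And>x. x \<in> S' \<inter> I \<Longrightarrow> T' x = B x"
    and T': "\<And>x. x \<in> S - I \<Longrightarrow> T' x = T x"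
    and B': "\<And>x. x \<in> I \<Longrightarrow> B' (B x) = B (T x)"
      "\<And>x. x \<in> S - I \<Longrightarrow> B x \<in> S - I \<Longrightarrow> B' x = B x"
  shows "jointly_transitive S' T' B'"
  unfolding jointly_transitive_def
proof (intro allI impI)
  fix Q' :: "'a \<Rightarrow> bool"
  assume ex: "\<exists>x\<in>S'. Q' x" and cl: "\<forall>x\<in>S'. Q' x \<longrightarrow> Q' (T' x) \<and> Q' (B' x)"
  \<comment> \<open>A vertex of \<open>I\<close> is merged with its partner \<open>B x\<close>, so
    it inherits the value there. This pulls a closed predicate of the contracted graph back to the
    original one.\<close>
  define Q where "Q x = (if x \<in> I then Q' (B x) else Q' x)" for x
  have "\<exists>x\<in>S. Q x"
  proof -
    obtain y where y: "y \<in> S'" "Q' y" using ex by blast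
    then have "Q y" using cl K(2)[of y] by (auto simp: Q_def)
    then show ?thesis using y sub by blast
  qed
  moreover have "Q (T x) \<and> Q (B x)" if x: "x \<in> S" "Q x" for x
  proof (cases "x \<in> I")
    case True
    then have Q: "Q' (B x)" using x by (simp add: Q_def)
    have 1: "Q' (B (T x))" using cl Q I(2)[OF True] B'(1)[OF True] by metis
    show ?thesis
    proof (cases "B x \<in> I")
      case BI: True
      then have "Q' x" using cl Q I(2)[OF True] K(2)[of "B x"] BB x by (metis IntI)
      then show ?thesis using 1 TI True BI BB x by (simp add: Q_def)
    next
      case False
      then show ?thesis using 1 TI True Q by (simp add: Q_def)
    qed
  next
    case False
    then have Q: "Q' x" "x \<in> S'" using x sub by (auto simp: Q_def)
    have 1: "Q (T x)" using cl Q T'[of x] TI(2)[of x] x False by (auto simp: Q_def)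
    show ?thesis
    proof (cases "B x \<in> I")
      case True
      then show ?thesis using 1 Q BB x by (simp add: Q_def)
    next
      case F: False
      then have "Q' (B x)" using cl Q B'(2)[of x] x False BB by auto
      then show ?thesis using 1 F by (simp add: Q_def)
    qed
  qed
  ultimately have all: "Q x" if "x \<in> S" for x
    using tr that unfolding jointly_transitive_def by blast
  show "\<forall>x\<in>S'. Q' x"
  proof
    fix x
    assume x: "x \<in> S'"
    show "Q' x"
    proof (cases "x \<in> I")
      case True
      then have "Q' (B x)" "B x \<in> S' \<inter> I" using all[of x] x sub K I by (auto simp: Q_def)
      moreover have "T' (B x) = x"
        using calculation K(2)[of "B x"] BB[of x] x sub by auto
      ultimately show ?thesis using cl by (metis IntD1)
    next
      case False
      then show ?thesis using all[of x] x sub by (auto simp: Q_def)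
    qed
  qed
qed

text \<open>The first class is the interval from \<open>s\<close> to \<open>T s\<close>: since
  \<open>T x + x\<close> is constant on it and \<open>T x\<close> is at least \<open>s\<close>, no
  member exceeds \<open>T s\<close>, and monotonicity of \<open>t\<close> gives the
  converse.\<close>

lemma reverses_classes_first:
  assumes "reverses_classes s n t T" "s \<le> x" "x < n"
  shows "t x = t s \<longleftrightarrow> x \<le> T s" and "x \<le> T s \<Longrightarrow> T x = T s + s - x" and "T s < n" and "s \<le> T s"
proof -
  note d = assms(1)[unfolded reverses_classes_def]
  have s: "s \<in> {s..<n}" and x: "x \<in> {s..<n}" using assms by auto
  have Ts: "T s \<in> {s..<n}" "t (T s) = t s" using d s by auto
  show "T s < n" "s \<le> T s" using Ts by auto
  have le: "t x = t s" if "x \<le> T s"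
    using d s x Ts that by (metis atLeastLessThan_iff le_antisym)
  show iff: "t x = t s \<longleftrightarrow> x \<le> T s"
  proof
    assume "t x = t s"
    then have "T x + x = T s + s" using d s x by blast
    moreover have "s \<le> T x" using d x by auto
    ultimately show "x \<le> T s" by simp
  qed (rule le)
  show "T x = T s + s - x" if "x \<le> T s"
  proof -
    have "T x + x = T s + s" using d s x le[OF that] by blast
    then show ?thesis by simp
  qed
qed

text \<open>The points \<open>x\<close> and \<open>T x\<close> lie in one class, so they have the
  same sum with their images, and \<open>T (T x) = x\<close> follows.\<close>

lemma reverses_classes_involution:
  assumes "reverses_classes s n t T" "s \<le> x" "x < n"
  shows "T (T x) = x" "s \<le> T x" "T x < n" "t (T x) = t x"
proof -
  note d = assms(1)[unfolded reverses_classes_def]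
  have x: "x \<in> {s..<n}" using assms by auto
  then have Tx: "T x \<in> {s..<n}" "t (T x) = t x" using d by auto
  then show "s \<le> T x" "T x < n" "t (T x) = t x" by auto
  have "T (T x) + T x = T x + x" using d x Tx by blast
  then show "T (T x) = x" by simp
qed

text \<open>With \<open>t\<close> and \<open>u\<close> the block numbers in the top and bottom
  compositions, these are the positions that are block upper triangular for the top and block lower
  triangular for the bottom.\<close>

definition seaweed_rel :: "(nat \<Rightarrow> nat) \<Rightarrow> (nat \<Rightarrow> nat) \<Rightarrow> nat \<Rightarrow> nat \<Rightarrow> bool" where
  "seaweed_rel t u r c \<longleftrightarrow> t r \<le> t c \<and> u c \<le> u r"

text \<open>A connected meander that is not a cycle: a graph of degree at most two in which some vertex lacks
  an edge.\<close>

definition meander_path ::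
  "nat \<Rightarrow> nat \<Rightarrow> (nat \<Rightarrow> nat) \<Rightarrow> (nat \<Rightarrow> nat) \<Rightarrow> (nat \<Rightarrow> nat) \<Rightarrow> (nat \<Rightarrow> nat) \<Rightarrow> bool" where
  "meander_path s n t u T B \<longleftrightarrow> s < n \<and> reverses_classes s n t T \<and> reverses_classes s n u B \<and>
     jointly_transitive {s..<n} T B \<and> (\<exists>x\<in>{s..<n}. T x = x \<or> B x = x)"

lemma meander_path_commute: "meander_path s n t u T B \<Longrightarrow> meander_path s n u t B T"
  unfolding meander_path_def using jointly_transitive_commute by metis

text \<open>Let the first top and bottom blocks have sizes p < q. If 2p is at most q, the top block
  disappears and the bottom block is replaced by blocks of sizes q - 2p and p, by injective
  absorption. Otherwise the top block shrinks to 2p - q and the bottom block to p, by surjective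
  absorption.\<close>

lemma meander_path_contract:
  assumes mp: "meander_path s n t u T B" and less: "T s < B s"
  obtains s' t' u' T' B' where "s < s'" "meander_path s' n t' u' T' B'"
    "\<And>F' :: nat \<Rightarrow> nat \<Rightarrow> 'k::field. rigid {s'..<n} (seaweed_rel t' u') F' \<Longrightarrow>
       \<exists>F :: nat \<Rightarrow> nat \<Rightarrow> 'k. rigid {s..<n} (seaweed_rel t u) F"
proof -
  define e f where "e = T s" and "f = B s"
  have ef: "e < f" using less by (simp add: e_def f_def)
  have rT: "reverses_classes s n t T" and rB: "reverses_classes s n u B" and sn: "s < n"
    and tr: "jointly_transitive {s..<n} T B"
    and fixpt: "\<exists>x\<in>{s..<n}. T x = x \<or> B x = x"
    using mp by (auto simp: meander_path_def)
  note dT = rT[unfolded reverses_classes_def] and dB = rB[unfolded reverses_classes_def]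
  note fT = reverses_classes_first[OF rT, folded e_def]
  note fB = reverses_classes_first[OF rB, folded f_def]
  note iT = reverses_classes_involution[OF rT]
  note iB = reverses_classes_involution[OF rB]
  have mt: "t x \<le> t y" if "s \<le> x" "x \<le> y" "y < n" for x y using dT that by auto
  have mu: "u x \<le> u y" if "s \<le> x" "x \<le> y" "y < n" for x y using dB that by auto
  have fn: "f < n" and se: "s \<le> e" using fB(3)[of s] fT(4)[of s] sn by auto
  have te: "t x = t s" if "s \<le> x" "x \<le> e" for x using fT(1)[of x] that ef fn by auto
  have tgt: "t s < t x" if "e < x" "x < n" for x
    using fT(1)[of x] mt[of s x] that se by auto
  have uf: "u x = u s" if "s \<le> x" "x \<le> f" for x using fB(1)[of x] that fn by auto
  have ugt: "u s < u x" if "f < x" "x < n" for x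
    using fB(1)[of x] mu[of s x] that se ef by auto
  have Te: "T x = e + s - x" if "s \<le> x" "x \<le> e" for x using fT(2)[of x] that ef fn by auto
  have Bf: "B x = f + s - x" if "s \<le> x" "x \<le> f" for x using fB(2)[of x] that fn by auto
  have Tgt: "e < T x \<and> T x < n" if "e < x" "x < n" for x
    using iT[of x] tgt[of x] te[of "T x"] that se by (metis less_le_trans not_le order_less_imp_le order_less_irrefl)
  have Bgt: "f < B x \<and> B x < n" if "f < x" "x < n" for x
    using iB[of x] ugt[of x] uf[of "B x"] that se ef by (metis less_le_trans not_le order_less_imp_le order_less_irrefl)
  \<comment> \<open>On \<open>{f + s - e..f}\<close>, the image of the first top block under
    \<open>B\<close>, this is the conjugate \<open>B T B\<close>: the top edges of the first block
    transported along the bottom edges. Both cases use it.\<close>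
  define B' where "B' x = (if f + s - e \<le> x \<and> x \<le> f then 2 * f + s - e - x else B x)" for x
  define T' where "T' x = (if x \<le> e then f + s - x else T x)" for x
  show thesis
  proof (cases "e < f + s - e")
    case True
    \<comment> \<open>Splits the rest of the first bottom block at \<open>f + s - e\<close>; every
      later rank moves up by one to make room. The first piece is empty when the top block is
      exactly half as long as the bottom one.\<close>
    define u' where "u' x = (if x < f + s - e then u x else Suc (u x))" for x
    have rT': "reverses_classes (Suc e) n t T"
      unfolding reverses_classes_def using dT se Tgt by (auto simp: Suc_le_eq)
    have u'_mono: "u' x \<le> u' y" if "Suc e \<le> x" "x \<le> y" "y < n" for x y
      using mu[of x y] that se by (auto simp: u'_def)
    have u'_U: "u' x = Suc (u s)" if "f + s - e \<le> x" "x \<le> f" for x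
      using uf[of x] that True se by (auto simp: u'_def)
    have u'_M: "u' x = u s" if "e < x" "x < f + s - e" for x
      using uf[of x] that True se by (auto simp: u'_def)
    have u'_gt: "u' x = Suc (u x)" "u s < u x" if "f < x" "x < n" for x
      using that ugt[of x] se by (auto simp: u'_def)
    have B'U: "B' x = 2 * f + s - e - x" if "f + s - e \<le> x" "x \<le> f" for x
      using that by (simp add: B'_def)
    have B'M: "B' x = f + s - x" if "e < x" "x < f + s - e" for x
      using that se Bf[of x] by (simp add: B'_def)
    have B'gt: "B' x = B x" if "f < x" for x
      using that by (simp add: B'_def)
    have rB': "reverses_classes (Suc e) n u' B'"
      unfolding reverses_classes_def
    proof (intro conjI ballI impI)
      show "u' x \<le> u' y" if "x \<in> {Suc e..<n}" "y \<in> {Suc e..<n}" "x \<le> y" for x y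
        using that u'_mono by auto
      show "B' x \<in> {Suc e..<n}" if "x \<in> {Suc e..<n}" for x
      proof -
        consider "x < f + s - e" | "f + s - e \<le> x" "x \<le> f" | "f < x" by linarith
        then show ?thesis
          using that B'U[of x] B'M[of x] B'gt[of x] Bgt[of x] True fn se ef by cases auto
      qed
      show "u' (B' x) = u' x" if "x \<in> {Suc e..<n}" for x
      proof -
        consider "x < f + s - e" | "f + s - e \<le> x" "x \<le> f" | "f < x" by linarith
        then show ?thesis
        proof cases
          case 1
          then have "e < B' x" "B' x < f + s - e" using that B'M[of x] se by auto
          then show ?thesis using 1 that u'_M by simp
        next
          case 2
          then have "f + s - e \<le> B' x" "B' x \<le> f" using that B'U[of x] se ef by auto
          then show ?thesis using 2 u'_U by simp
        next
          case 3
          then show ?thesis using that Bgt[of x] u'_gt[of x] u'_gt[of "B x"] iB[of x] se B'gt[of x] by simp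
        qed
      qed
      show "B' x + x = B' y + y" if "x \<in> {Suc e..<n}" "y \<in> {Suc e..<n}" "u' x = u' y" for x y
      proof -
        consider "x < f + s - e" | "f + s - e \<le> x" "x \<le> f" | "f < x" by linarith
        then show ?thesis
        proof cases
          case 1
          then have "y < f + s - e"
            using that u'_M[of x] u'_U[of y] u'_gt[of y] by (cases "y \<le> f") fastforce+
          then show ?thesis using 1 that B'M se by simp
        next
          case 2
          then have "f + s - e \<le> y \<and> y \<le> f"
            using that u'_U[of x] u'_M[of y] u'_gt[of y] by (cases "y \<le> f"; cases "y < f + s - e") auto
          then show ?thesis using 2 B'U se ef by simp
        next
          case 3
          then have "f < y"
            using that u'_gt[of x] u'_M[of y] u'_U[of y] by (cases "y < f + s - e") fastforce+
          then have "B x + x = B y + y"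
            using 3 that u'_gt[of x] u'_gt[of y] dB se by simp
          then show ?thesis using 3 \<open>f < y\<close> B'gt by simp
        qed
      qed
    qed
    have tr': "jointly_transitive {Suc e..<n} T B'"
    proof (rule jointly_transitive_contract[OF tr, where I = "{s..e}"])
      show "B' (B x) = B (T x)" if "x \<in> {s..e}" for x
        using that Te[of x] Bf[of x] Bf[of "T x"] B'U[of "B x"] ef by auto
      show "B' x = B x" if x: "x \<in> {s..<n} - {s..e}" "B x \<in> {s..<n} - {s..e}" for x
      proof -
        have "\<not> (f + s - e \<le> x \<and> x \<le> f)"
          using x Bf[of x] by auto
        then show ?thesis by (auto simp: B'_def)
      qed
      show "T x \<in> {s..<n} - {s..e}" if "x \<in> {s..<n} - {s..e}" for x
        using that Tgt[of x] se by auto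
    qed (use se ef fn True Te iB Bf in auto)
    \<comment> \<open>A fixed point of \<open>T\<close> in the removed block turns into a fixed
      point of \<open>B'\<close> at its partner \<open>f + s - x\<close>. A fixed point of
      \<open>B\<close> lies neither in that block nor in its mirror image, so \<open>B'\<close>
      still fixes it.\<close>
    have fix': "\<exists>x\<in>{Suc e..<n}. T x = x \<or> B' x = x"
    proof -
      obtain x where x: "s \<le> x" "x < n" "T x = x \<or> B x = x" using fixpt by auto
      show ?thesis
      proof (cases "x \<le> e")
        case le: True
        then have "T x = x" using x Bf[of x] True ef by auto
        then have "B' (f + s - x) = f + s - x"
          using le x Te[of x] B'U[of "f + s - x"] ef by simp
        then show ?thesis using le x True fn ef by (intro bexI[of _ "f + s - x"]) auto
      next
        case False
        have "B' x = x" if "B x = x"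
        proof -
          have "\<not> (f + s - e \<le> x \<and> x \<le> f)"
            using that Bf[of x] True False x by auto
          then show ?thesis using that by (auto simp: B'_def)
        qed
        then show ?thesis using x False by (intro bexI[of _ x]) auto
      qed
    qed
    have mp': "meander_path (Suc e) n t u' T B'"
      using rT' rB' tr' fix' ef fn by (simp add: meander_path_def)
    have "\<exists>F :: nat \<Rightarrow> nat \<Rightarrow> 'k. rigid {s..<n} (seaweed_rel t u) F"
      if F': "rigid {Suc e..<n} (seaweed_rel t u') F'" for F' :: "nat \<Rightarrow> nat \<Rightarrow> 'k"
    proof -
      have im: "(\<lambda>x. f + s - x) ` {s..e} = {f + s - e..f}"
      proof
        show "{f + s - e..f} \<subseteq> (\<lambda>x. f + s - x) ` {s..e}"
        proof
          fix y assume "y \<in> {f + s - e..f}"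
          then show "y \<in> (\<lambda>x. f + s - x) ` {s..e}"
            using ef by (intro image_eqI[of _ _ "f + s - y"]) auto
        qed
      qed (use ef in auto)
      have S: "{s..<n} = {s..e} \<union> {Suc e..<n}" using se ef fn by auto
      show ?thesis
        unfolding S
      proof (rule rigid_absorb_injective[where \<phi> = "\<lambda>x. f + s - x" and M = "{Suc e..f}" and F' = F'])
        show "inj_on (\<lambda>x. f + s - x) {s..e}" using ef by (auto simp: inj_on_def)
        show "seaweed_rel t u i j" if "i \<in> {s..e}" "j \<in> {s..e}" for i j
          using that te[of i] te[of j] uf[of i] uf[of j] ef by (simp add: seaweed_rel_def)
        show "\<not> seaweed_rel t u w i" if "w \<in> {Suc e..<n}" "i \<in> {s..e}" for w i
          using that te[of i] tgt[of w] by (simp add: seaweed_rel_def)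
        show "seaweed_rel t u i w \<longleftrightarrow> w \<in> {Suc e..f}" if "i \<in> {s..e}" "w \<in> {Suc e..<n}" for i w
          using that te[of i] tgt[of w] uf[of i] uf[of w] ugt[of w] ef se
          by (cases "w \<le> f") (auto simp: seaweed_rel_def)
        show "seaweed_rel t u w (f + s - i)"
          if "w \<in> {Suc e..f} - (\<lambda>x. f + s - x) ` {s..e}" "i \<in> {s..e}" for w i
          using that uf[of w] uf[of "f + s - i"] ef se fn unfolding im
          by (auto simp: seaweed_rel_def intro!: mt)
        \<comment> \<open>Forbidding the positions from absorption is the same as splitting the
          bottom block: the new rank separates exactly the rows \<open>{Suc e..<f + s - e}\<close>
          from the columns \<open>{f + s - e..f}\<close>.\<close>
        have "seaweed_rel t u r c \<and> \<not> (r \<in> {Suc e..f} - {f + s - e..f} \<and> c \<in> {f + s - e..f}) \<longleftrightarrow> seaweed_rel t u' r c"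
          if rc: "r \<in> {Suc e..<n}" "c \<in> {Suc e..<n}" for r c
        proof -
          consider "r < f + s - e" | "f + s - e \<le> r" "r \<le> f" | "f < r" by linarith
          then show ?thesis
          proof cases
            case 1
            then have r: "u r = u s" "u' r = u s" using rc uf[of r] u'_M[of r] se by auto
            show ?thesis
              using 1 rc r uf[of c] u'_U[of c] u'_M[of c] u'_gt[of c] se
              by (cases "c < f + s - e"; cases "c \<le> f") (auto simp: seaweed_rel_def)
          next
            case 2
            then have r: "u r = u s" "u' r = Suc (u s)" using rc uf[of r] u'_U[of r] se by auto
            show ?thesis
              using 2 rc r uf[of c] u'_U[of c] u'_M[of c] u'_gt[of c] se
              by (cases "c < f + s - e"; cases "c \<le> f") (auto simp: seaweed_rel_def)
          next
            case 3
            then have r: "u' r = Suc (u r)" "u s < u r" using rc u'_gt[of r] by auto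
            show ?thesis
              using 3 rc r uf[of c] u'_U[of c] u'_M[of c] u'_gt[of c] se
              by (cases "c < f + s - e"; cases "c \<le> f") (auto simp: seaweed_rel_def)
          qed
        qed
        then show "rigid {Suc e..<n} (\<lambda>r c. seaweed_rel t u r c \<and>
            \<not> (r \<in> {Suc e..f} - (\<lambda>x. f + s - x) ` {s..e} \<and> c \<in> (\<lambda>x. f + s - x) ` {s..e})) F'"
          unfolding im using F' by (subst rigid_cong[where R' = "seaweed_rel t u'"]) auto
      qed (use im True ef fn in auto)
    qed
    then show thesis using that[of "Suc e", OF _ mp'] se by simp
  next
    case False
    \<comment> \<open>Here the first top block overlaps its mirror image, in \<open>{s'..e}\<close>.
      The vertices before \<open>s'\<close> are matched with \<open>{Suc e..f}\<close> and removed;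
      on the overlap the old bottom edges become the new top edges, and the ranks stay as they
      are.\<close>
    define s' where "s' = f + s - e"
    have s': "s < s'" "s' \<le> e" using False ef by (auto simp: s'_def)
    have tK: "t x = t s" if "s' \<le> x" "x \<le> e" for x using te[of x] that s' by auto
    have uP: "u x = u s" if "s' \<le> x" "x \<le> f" for x using uf[of x] that s' by auto
    have T'K: "T' x = f + s - x" if "x \<le> e" for x using that by (simp add: T'_def)
    have T'gt: "T' x = T x" if "e < x" for x using that by (simp add: T'_def)
    have B'P: "B' x = 2 * f + s - e - x" if "s' \<le> x" "x \<le> f" for x
      using that by (simp add: B'_def s'_def)
    have B'gt: "B' x = B x" if "f < x" for x using that by (simp add: B'_def)
    have rT': "reverses_classes s' n t T'"
      unfolding reverses_classes_def
    proof (intro conjI ballI impI)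
      show "t x \<le> t y" if "x \<in> {s'..<n}" "y \<in> {s'..<n}" "x \<le> y" for x y
        using that mt s' by auto
      show "T' x \<in> {s'..<n}" if "x \<in> {s'..<n}" for x
        using that T'K[of x] T'gt[of x] Tgt[of x] s' ef fn by (cases "x \<le> e") (auto simp: s'_def)
      show "t (T' x) = t x" if "x \<in> {s'..<n}" for x
      proof (cases "x \<le> e")
        case True
        then have "s' \<le> T' x" "T' x \<le> e" using that T'K[of x] ef by (auto simp: s'_def)
        then show ?thesis using True that tK by auto
      next
        case False
        then show ?thesis using that T'gt[of x] iT[of x] s' by auto
      qed
      show "T' x + x = T' y + y" if "x \<in> {s'..<n}" "y \<in> {s'..<n}" "t x = t y" for x y
      proof (cases "x \<le> e")
        case True
        then have "y \<le> e" using that tK[of x] tgt[of y] by fastforce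
        then show ?thesis using True T'K ef by simp
      next
        case False
        then have "e < y" using that tK[of y] tgt[of x] by fastforce
        moreover have "T x + x = T y + y" using that dT s' by simp
        ultimately show ?thesis using False T'gt by simp
      qed
    qed
    have rB': "reverses_classes s' n u B'"
      unfolding reverses_classes_def
    proof (intro conjI ballI impI)
      show "u x \<le> u y" if "x \<in> {s'..<n}" "y \<in> {s'..<n}" "x \<le> y" for x y
        using that mu s' by auto
      show "B' x \<in> {s'..<n}" if "x \<in> {s'..<n}" for x
        using that B'P[of x] B'gt[of x] Bgt[of x] s' ef fn by (cases "x \<le> f") (auto simp: s'_def)
      show "u (B' x) = u x" if "x \<in> {s'..<n}" for x
      proof (cases "x \<le> f")
        case True
        then have "s' \<le> B' x" "B' x \<le> f" using that B'P[of x] ef by (auto simp: s'_def)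
        then show ?thesis using True that uP by auto
      next
        case False
        then show ?thesis using that B'gt[of x] iB[of x] s' by auto
      qed
      show "B' x + x = B' y + y" if "x \<in> {s'..<n}" "y \<in> {s'..<n}" "u x = u y" for x y
      proof (cases "x \<le> f")
        case True
        then have "y \<le> f" using that uP[of x] ugt[of y] by fastforce
        then show ?thesis using True that B'P ef by simp
      next
        case False
        then have "f < y" using that uP[of y] ugt[of x] by fastforce
        moreover have "B x + x = B y + y" using that dB s' by simp
        ultimately show ?thesis using False B'gt by simp
      qed
    qed
    have tr': "jointly_transitive {s'..<n} T' B'"
    proof (rule jointly_transitive_contract[OF tr, where I = "{s..e}"])
      show "B' (B x) = B (T x)" if "x \<in> {s..e}" for x
        using that Te[of x] Bf[of x] Bf[of "T x"] B'P[of "B x"] ef by (auto simp: s'_def)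
      show "B' x = B x" if x: "x \<in> {s..<n} - {s..e}" "B x \<in> {s..<n} - {s..e}" for x
        using x Bf[of x] False by (cases "x \<le> f") (auto simp: B'_def)
      show "B x \<in> {s..e}" "T' x = B x" if "x \<in> {s'..<n} \<inter> {s..e}" for x
        using that Bf[of x] T'K[of x] ef by (auto simp: s'_def)
      show "T x \<in> {s..<n} - {s..e}" if "x \<in> {s..<n} - {s..e}" for x
        using that Tgt[of x] se by auto
    qed (use se ef fn s' Te iB Bf T'gt in \<open>auto simp: s'_def\<close>)
    \<comment> \<open>The middle of the first top block passes to its partner as a fixed point of
      \<open>B'\<close>. The middle of the first bottom block is also the middle of the overlap, so
      \<open>T'\<close> fixes it.\<close>
    have fix': "\<exists>x\<in>{s'..<n}. T' x = x \<or> B' x = x"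
    proof -
      obtain x where x: "s \<le> x" "x < n" "T x = x \<or> B x = x" using fixpt by auto
      consider "x \<le> e" "T x = x" | "x \<le> f" "B x = x" | "e < x" "T x = x" | "f < x" "B x = x"
        using x by linarith
      then show ?thesis
      proof cases
        case 1
        then have "B' (f + s - x) = f + s - x"
          using x Te[of x] B'P[of "f + s - x"] ef by (simp add: s'_def)
        then show ?thesis using 1 x fn ef by (intro bexI[of _ "f + s - x"]) (auto simp: s'_def)
      next
        case 2
        then have "x \<le> e" "s' \<le> x" "T' x = x"
          using x Bf[of x] T'K[of x] s' by (auto simp: s'_def)
        then show ?thesis using x by (intro bexI[of _ x]) auto
      next
        case 3
        then show ?thesis using x T'gt[of x] s' by (intro bexI[of _ x]) auto
      next
        case 4
        then show ?thesis using x B'gt[of x] s' ef by (intro bexI[of _ x]) auto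
      qed
    qed
    have mp': "meander_path s' n t u T' B'"
      using rT' rB' tr' fix' ef fn s' by (simp add: meander_path_def)
    have "\<exists>F :: nat \<Rightarrow> nat \<Rightarrow> 'k. rigid {s..<n} (seaweed_rel t u) F"
      if F': "rigid {s'..<n} (seaweed_rel t u) F'" for F' :: "nat \<Rightarrow> nat \<Rightarrow> 'k"
    proof -
      have bij: "bij_betw (\<lambda>x. f + s - x) {s..<s'} {Suc e..f}"
        by (rule bij_betw_byWitness[where f' = "\<lambda>x. f + s - x"]) (use s' ef in \<open>auto simp: s'_def\<close>)
      have S: "{s..<n} = {s'..e} \<union> {s..<s'} \<union> {Suc e..<n}" using se ef fn s' by auto
      have S': "{s'..<n} = {s'..e} \<union> {Suc e..<n}" using ef fn s' by auto
      show ?thesis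
        unfolding S
      proof (rule rigid_absorb_surjective[OF _ _ _ _ _ bij, where F' = F'])
        show "seaweed_rel t u i j" if "i \<in> {s'..e} \<union> {s..<s'}" "j \<in> {s'..e} \<union> {s..<s'}" for i j
          using that te[of i] te[of j] uf[of i] uf[of j] ef s' by (auto simp: seaweed_rel_def)
        show "\<not> seaweed_rel t u w i" if "w \<in> {Suc e..<n}" "i \<in> {s'..e} \<union> {s..<s'}" for w i
          using that te[of i] tgt[of w] s' by (auto simp: seaweed_rel_def)
        show "seaweed_rel t u i w \<longleftrightarrow> w \<in> {Suc e..f}"
          if "i \<in> {s'..e} \<union> {s..<s'}" "w \<in> {Suc e..<n}" for i w
          using that te[of i] tgt[of w] uf[of i] uf[of w] ugt[of w] ef se s'
          by (cases "w \<le> f") (auto simp: seaweed_rel_def)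
        show "rigid ({s'..e} \<union> {Suc e..<n}) (seaweed_rel t u) F'"
          using F' S' by simp
      qed (use s' ef fn in auto)
    qed
    then show thesis using that[of s', OF _ mp'] s' by simp
  qed
qed

text \<open>Induction on the number of vertices. When the first top block is the longer one, top and
  bottom are exchanged and the resulting functional is transposed back.\<close>

lemma meander_path_rigid:
  assumes "meander_path s n t u T B"
  shows "\<exists>F :: nat \<Rightarrow> nat \<Rightarrow> 'k::field. rigid {s..<n} (seaweed_rel t u) F"
  using assms
proof (induction "n - s" arbitrary: s t u T B rule: less_induct)
  case less
  have step: "\<exists>F :: nat \<Rightarrow> nat \<Rightarrow> 'k. rigid {s..<n} (seaweed_rel t u) F"
    if mp: "meander_path s n t u T B" and lt: "T s < B s" for t u T B
  proof -
    obtain s' t' u' T' B' where s': "s < s'" and mp': "meander_path s' n t' u' T' B'"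
      and F: "\<And>F' :: nat \<Rightarrow> nat \<Rightarrow> 'k. rigid {s'..<n} (seaweed_rel t' u') F' \<Longrightarrow>
         \<exists>F :: nat \<Rightarrow> nat \<Rightarrow> 'k. rigid {s..<n} (seaweed_rel t u) F"
      using meander_path_contract[OF mp lt] by metis
    have "n - s' < n - s" using s' mp' by (auto simp: meander_path_def)
    then obtain F' :: "nat \<Rightarrow> nat \<Rightarrow> 'k" where "rigid {s'..<n} (seaweed_rel t' u') F'"
      using less.hyps mp' by blast
    then show ?thesis by (rule F)
  qed
  consider "T s < B s" | "B s < T s" | "T s = B s" by linarith
  then show ?case
  proof cases
    case 1
    then show ?thesis by (rule step[OF less.prems])
  next
    case 2
    then obtain F :: "nat \<Rightarrow> nat \<Rightarrow> 'k" where "rigid {s..<n} (seaweed_rel u t) F"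
      using step[OF meander_path_commute[OF less.prems]] by blast
    from rigid_transpose[OF this] have "rigid {s..<n} (\<lambda>i j. seaweed_rel u t j i) (\<lambda>i j. F j i)" .
    moreover have "(\<lambda>i j. seaweed_rel u t j i) = seaweed_rel t u"
      by (auto simp: seaweed_rel_def fun_eq_iff)
    ultimately show ?thesis by auto
  next
    case 3
    define e where "e = T s"
    have rT: "reverses_classes s n t T" and rB: "reverses_classes s n u B" and sn: "s < n"
      and tr: "jointly_transitive {s..<n} T B"
      and fixpt: "\<exists>x\<in>{s..<n}. T x = x \<or> B x = x"
      using less.prems by (auto simp: meander_path_def)
    note fT = reverses_classes_first[OF rT, folded e_def]
    note fB = reverses_classes_first[OF rB, folded 3, folded e_def]
    have TB: "T x = e + s - x" "B x = e + s - x" if "s \<le> x" "x \<le> e" for x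
      using that fT(2)[of x] fB(2)[of x] fT(3)[of s] sn by auto
    \<comment> \<open>The first blocks coincide, so their vertex set is closed and by connectedness
      is everything. Both maps are then the same reflection, whose fixed point is a component by
      itself, so only one vertex remains.\<close>
    have all: "x \<le> e" if "s \<le> x" "x < n" for x
    proof -
      have "\<exists>x\<in>{s..<n}. x \<le> e" using fT(4)[of s] sn by auto
      moreover have "\<forall>x\<in>{s..<n}. x \<le> e \<longrightarrow> T x \<le> e \<and> B x \<le> e" using TB by auto
      ultimately show ?thesis
        using tr[unfolded jointly_transitive_def, rule_format, of "\<lambda>x. x \<le> e" x] that by auto
    qed
    obtain x where x: "x \<in> {s..<n}" "T x = x \<or> B x = x" using fixpt by blast
    then have "T x = x" "B x = x" using TB[of x] all[of x] by auto
    then have "y = x" if "y \<in> {s..<n}" for y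
      using tr[unfolded jointly_transitive_def, rule_format, of "\<lambda>y. y = x" y] that x by auto
    then have "{s..<n} = {x}" using x(1) by blast
    then show ?thesis using rigid_singleton[of "seaweed_rel t u" x] by (auto simp: seaweed_rel_def)
  qed
qed

subsection \<open>Connectedness of the meander\<close>

text \<open>As \<open>a\<close> is even and \<open>b\<close> odd, \<open>j * b mod a\<close> has the
  parity of \<open>j\<close>, so the sign of each term is the parity sign of the residue.
  Multiplication by \<open>b\<close> permutes the residues, which leaves the alternating sum of all
  \<open>r < a\<close>.\<close>

lemma sum_alternating_residues:
  fixes a b :: nat
  assumes "even a" "coprime a b"
  shows "(\<Sum>i<a div 2. int ((2 * i + 1) * b mod a) - int (2 * i * b mod a)) = int a div 2"
proof (cases "a = 0")
  case False
  define g :: "nat \<Rightarrow> int" where "g r = (if even r then - int r else int r)" for r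
  obtain m where m: "a = 2 * m" using assms by (auto elim: evenE)
  have b: "odd b" using assms by (metis coprime_common_divisor odd_one)
  have par: "even (j * b mod a) \<longleftrightarrow> even j" for j
    using assms b by (simp add: dvd_mod_iff)
  have "(\<Sum>i<l. int ((2 * i + 1) * b mod a) - int (2 * i * b mod a)) = (\<Sum>j<2 * l. g (j * b mod a))" for l
    by (induction l) (simp_all add: g_def par del: mult_Suc)
  then have "(\<Sum>i<a div 2. int ((2 * i + 1) * b mod a) - int (2 * i * b mod a)) = (\<Sum>j<a. g (j * b mod a))"
    using m by simp
  also have "\<dots> = (\<Sum>r<a. g r)"
  proof (rule sum.reindex_bij_betw)
    have inj: "inj_on (\<lambda>j. j * b mod a) {..<a}"
    proof (rule inj_onI)
      fix i j assume ij: "i \<in> {..<a}" "j \<in> {..<a}" "i * b mod a = j * b mod a"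
      then have "[i = j] (mod a)"
        using assms cong_mult_rcancel_nat[of b a i j] by (simp add: cong_def coprime_commute)
      then show "i = j" using ij by (simp add: cong_def)
    qed
    moreover have "(\<lambda>j. j * b mod a) ` {..<a} \<subseteq> {..<a}"
      using False by auto
    ultimately show "bij_betw (\<lambda>j. j * b mod a) {..<a} {..<a}"
      by (simp add: bij_betw_def endo_inj_surj)
  qed
  also have "\<dots> = int a div 2"
    unfolding m by (induction m) (simp_all add: g_def)
  finally show ?thesis .
qed simp

text \<open>The top rank is capped at \<open>k\<close> because the last block may be longer than
  \<open>a\<close>. The map \<open>T\<close> reflects block \<open>q\<close> with constant sum
  \<open>(2 * q + 1) * a - 1\<close>.\<close>

lemma meander_path_blocks:
  fixes a b k :: nat
  assumes a: "a > 0" "even a" and b: "b > 0" and co: "gcd a b = 1" and k: "k \<ge> 1"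
  defines "n \<equiv> k * a + b"
  defines "T \<equiv> \<lambda>x. if x < k * a then (2 * (x div a) + 1) * a - 1 - x else k * a + (n - 1) - x"
  shows "meander_path 0 n (\<lambda>x. min (x div a) k) (\<lambda>_. 0) T (\<lambda>x. n - 1 - x)"
proof -
  let ?B = "\<lambda>x. n - 1 - x" and ?t = "\<lambda>x. min (x div a) k"
  have n: "n > 0" using b by (simp add: n_def)
  have bodd: "odd b" using a co by (metis gcd_greatest_iff odd_one)
  have lt: "q * a + r < k * a" if "r < a" "q < k" for q r
  proof -
    have "q * a + r < Suc q * a" using that by simp
    also have "\<dots> \<le> k * a" using that by (intro mult_le_mono1) simp
    finally show ?thesis .
  qed
  have T1: "T (q * a + r) = q * a + (a - 1 - r)" if "r < a" "q < k" for q r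
  proof -
    have "q * a + r < k * a"
      using that by (rule lt)
    moreover have "(q * a + r) div a = q" using that by simp
    ultimately show ?thesis using that by (simp add: T_def algebra_simps)
  qed
  have T2: "T x = k * a + (n - 1) - x" if "k * a \<le> x" for x
    using that by (simp add: T_def)
  have dec: "\<exists>q r. x = q * a + r \<and> r < a \<and> q < k" if "x < k * a" for x
    using that a by (intro exI[of _ "x div a"] exI[of _ "x mod a"]) (simp add: less_mult_imp_div_less)
  have tq: "?t (q * a + r) = q" if "r < a" "q < k" for q r
    using that by simp
  have tk: "?t x = k" if "k * a \<le> x" for x
  proof -
    have "k \<le> x div a" using that a by (simp add: less_eq_div_iff_mult_less_eq)
    then show ?thesis by simp
  qed
  have rT: "reverses_classes 0 n ?t T"
    unfolding reverses_classes_def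
  proof (intro conjI ballI impI)
    show "?t x \<le> ?t y" if "x \<le> y" for x y
      using div_le_mono[OF that, of a] by auto
    fix x assume x: "x \<in> {0..<n}"
    show "T x \<in> {0..<n}"
    proof (cases "x < k * a")
      case True
      then obtain q r where q: "x = q * a + r" "r < a" "q < k" using dec by blast
      then show ?thesis using T1 lt[of "a - 1 - r" q] by (simp add: n_def)
    next
      case False
      then show ?thesis using x T2 by (auto simp: n_def)
    qed
    show "?t (T x) = ?t x"
    proof (cases "x < k * a")
      case True
      then obtain q r where q: "x = q * a + r" "r < a" "q < k" using dec by blast
      then show ?thesis using T1[of r q] tq[of r q] tq[of "a - 1 - r" q] by simp
    next
      case False
      then show ?thesis using x T2[of x] tk[of x] tk[of "T x"] by (simp add: n_def)
    qed
    fix y assume y: "y \<in> {0..<n}" and xy: "?t x = ?t y"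
    show "T x + x = T y + y"
    proof (cases "x < k * a")
      case True
      then obtain q r where q: "x = q * a + r" "r < a" "q < k" using dec by blast
      have "y < k * a" using xy q tq[of r q] tk[of y] by (cases "y < k * a") auto
      then obtain p s where p: "y = p * a + s" "s < a" "p < k" using dec by blast
      then show ?thesis using xy q tq[of r q] tq[of s p] T1[of r q] T1[of s p] by simp
    next
      case False
      have "k * a \<le> y"
      proof (rule ccontr)
        assume "\<not> k * a \<le> y"
        then obtain p s where p: "y = p * a + s" "s < a" "p < k" using dec[of y] by auto
        then show False using xy tk[of x] False tq[of s p] by simp
      qed
      then show ?thesis using False x y T2 by simp
    qed
  qed
  have rB: "reverses_classes 0 n (\<lambda>_. 0) ?B"
    by (auto simp: reverses_classes_def)
  have tr: "jointly_transitive {0..<n} T ?B"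
    unfolding jointly_transitive_def
  proof (intro allI impI)
    fix Q :: "nat \<Rightarrow> bool"
    assume ex: "\<exists>x\<in>{0..<n}. Q x" and cl: "\<forall>x\<in>{0..<n}. Q x \<longrightarrow> Q (T x) \<and> Q (?B x)"
    have QT: "Q (T x) \<longleftrightarrow> Q x" if "x < n" for x
      using cl that reverses_classes_involution[OF rT, of x] by (metis atLeastLessThan_iff le0)
    have QB: "Q (n - 1 - x) \<longleftrightarrow> Q x" if "x < n" for x
      using cl that reverses_classes_involution[OF rB, of x] by (metis atLeastLessThan_iff le0)
    \<comment> \<open>The bottom edge at \<open>x < b\<close> ends in the last top block, whose
      reflection leads on to \<open>x + k * a\<close>.\<close>
    have shift: "Q (x + k * a) \<longleftrightarrow> Q x" if "x < b" for x
    proof -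
      have "T (n - 1 - x) = x + k * a"
        using that T2[of "n - 1 - x"] by (simp add: n_def)
      then show ?thesis
        using that QB[of x] QT[of "n - 1 - x"] n by (simp add: n_def)
    qed
    have ka: "k * a > 0" using a k by simp
    have Qmod: "Q (y mod (k * a)) \<longleftrightarrow> Q y" if "y < n" for y
      using that
    proof (induction y rule: less_induct)
      case (less y)
      show ?case
      proof (cases "y < k * a")
        case False
        then have "Q ((y - k * a) mod (k * a)) \<longleftrightarrow> Q (y - k * a)"
          using less.prems False ka by (intro less.IH) linarith+
        then show ?thesis
          using False shift[of "y - k * a"] less.prems by (simp add: le_mod_geq n_def)
      qed simp
    qed
    \<comment> \<open>Reversal inside block \<open>q\<close> followed by the bottom edge: the offset
      \<open>r\<close> is reversed twice and survives, while the block number is reversed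
      once.\<close>
    have flip: "Q (b + ((k - 1 - q) * a + r)) \<longleftrightarrow> Q (q * a + r)" if "r < a" "q < k" for q r
    proof -
      define p where "p = k - Suc q"
      have p: "k = Suc (q + p)" using that(2) by (simp add: p_def)
      have kq: "k - 1 - q = p" by (simp add: p_def)
      have ka': "k * a = q * a + p * a + a" by (simp add: p add_mult_distrib)
      have "n - 1 - (b + ((k - 1 - q) * a + r)) = q * a + (a - 1 - r)"
        unfolding n_def kq ka' using that(1) by linarith
      moreover have "b + ((k - 1 - q) * a + r) < n"
        using that lt[of r "k - 1 - q"] by (simp add: n_def)
      moreover have "Q (T (q * a + (a - 1 - r))) \<longleftrightarrow> Q (q * a + (a - 1 - r))"
        using that lt[of "a - 1 - r" q] by (intro QT) (simp add: n_def)
      ultimately show ?thesis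
        using that QB T1[of "a - 1 - r" q] by force
    qed
    \<comment> \<open>\<open>Q\<close> only depends on residues modulo \<open>k a\<close>, on which \<open>T B\<close> acts as the shift by \<open>b\<close>
      followed by reversing the order of the \<open>k\<close> blocks. The reversals cancel in pairs because \<open>a\<close> is
      even, so \<open>a\<close> rounds map a block to a neighbouring one.\<close>
    define P where "P z = Q (nat (z mod int (k * a)))" for z :: int
    have P_cong: "P z = P w" if "[z = w] (mod int (k * a))" for z w
      using that by (simp add: P_def cong_def)
    have P_nat: "P (int y) \<longleftrightarrow> Q y" if "y < n" for y
      using Qmod[OF that] by (simp only: P_def zmod_int[symmetric] nat_int)
    \<comment> \<open>This is \<open>flip\<close> modulo \<open>k * a\<close>, where block
      \<open>k - 1 - q\<close> is block \<open>- q - 1\<close>. On the integers no subtraction is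
      truncated and the formula holds for every \<open>z\<close>.\<close>
    have single: "P (z + int b - (2 * (z div int a) + 1) * int a) \<longleftrightarrow> P z" for z
    proof -
      define q where "q = nat (z div int a mod int k)"
      define r where "r = nat (z mod int a)"
      have qr: "q < k" "r < a"
        using a k by (simp_all add: q_def r_def nat_less_iff)
      define c where "c = z div int a div int k"
      have qc: "z div int a = int q + c * int k"
        using k by (simp add: q_def c_def)
      have z: "z = (int q + c * int k) * int a + int r"
        unfolding qc[symmetric] using a by (simp add: r_def)
      have "P z \<longleftrightarrow> P (int (q * a + r))"
        by (rule P_cong) (auto simp: z cong_iff_dvd_diff algebra_simps intro!: dvd_mult)
      also have "\<dots> \<longleftrightarrow> P (int (b + ((k - 1 - q) * a + r)))"
      proof -
        have "q * a + r < n" "b + ((k - 1 - q) * a + r) < n"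
          using qr lt[of r q] lt[of r "k - 1 - q"] by (simp_all add: n_def)
        then show ?thesis using flip[of r q] qr by (simp only: P_nat)
      qed
      also have "\<dots> \<longleftrightarrow> P (z + int b - (2 * (z div int a) + 1) * int a)"
      proof (rule P_cong)
        have "int (b + ((k - 1 - q) * a + r)) - (z + int b - (2 * (z div int a) + 1) * int a)
            = (1 + c) * int (k * a)"
        proof -
          have "int (k - 1 - q) = int k - 1 - int q" using qr by simp
          then have "int (b + ((k - 1 - q) * a + r)) = int b + ((int k - 1 - int q) * int a + int r)"
            by (simp only: of_nat_add of_nat_mult)
          then show ?thesis
            unfolding qc by (subst z) (simp add: algebra_simps)
        qed
        then show "[int (b + ((k - 1 - q) * a + r)) = z + int b - (2 * (z div int a) + 1) * int a] (mod int (k * a))"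
          by (simp only: cong_iff_dvd_diff) simp
      qed
      finally show ?thesis by simp
    qed
    \<comment> \<open>Let \<open>z\<close> and \<open>z + b\<close> have block numbers p and q. Two
      single rounds give \<open>z + 2 b + 2 (p - q) a\<close>, and this is \<open>z\<close> plus
      twice the change of residue modulo \<open>a\<close>.\<close>
    have double: "P (z + 2 * ((z + int b) mod int a - z mod int a)) \<longleftrightarrow> P z" for z
    proof -
      have regroup: "Z + B + - (2 * p + 1) * A + B - (2 * (- (2 * p + 1) + q) + 1) * A
          = Z + 2 * ((Z + B - q * A) - (Z - p * A))" for Z B p q A :: int
        by (simp add: algebra_simps)
      define w where "w = z + int b - (2 * (z div int a) + 1) * int a"
      let ?p = "z div int a" and ?q = "(z + int b) div int a"
      have w: "w = (z + int b) + (- (2 * ?p + 1)) * int a"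
        unfolding w_def by (simp only: mult_minus_left diff_conv_add_uminus)
      have "w div int a = - (2 * ?p + 1) + ?q"
        unfolding w using a by (intro div_mult_self1) simp
      then have "w + int b - (2 * (w div int a) + 1) * int a
          = w + int b - (2 * (- (2 * ?p + 1) + ?q) + 1) * int a"
        by simp
      also have "\<dots> = z + 2 * ((z + int b - ?q * int a) - (z - ?p * int a))"
        unfolding w by (rule regroup)
      also have "\<dots> = z + 2 * ((z + int b) mod int a - z mod int a)"
        by (simp only: minus_div_mult_eq_mod)
      finally show ?thesis
        using single[of z] single[of w] by (simp only: w_def)
    qed
    let ?D = "\<lambda>m. \<Sum>i<m. int ((2 * i + 1) * b mod a) - int (2 * i * b mod a)"
    \<comment> \<open>After \<open>m\<close> double rounds from a block boundary the residue modulo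
      \<open>a\<close> is that of \<open>2 * m * b\<close>. So the displacements in
      \<open>double\<close> are the terms of the alternating sum.\<close>
    have residue: "[q * int a + 2 * ?D m = int (2 * m * b)] (mod int a)" for q m
    proof (induction m)
      case (Suc m)
      have "[(q * int a + 2 * ?D m) + 2 * (int ((2 * m + 1) * b mod a) - int (2 * m * b mod a))
          = int (2 * m * b) + 2 * (int ((2 * m + 1) * b) - int (2 * m * b))] (mod int a)"
        by (intro cong_add cong_mult cong_diff Suc.IH cong_refl) (simp_all add: zmod_int cong_def)
      then show ?case by (simp add: algebra_simps)
    qed (simp add: cong_def)
    have iter: "P (q * int a + 2 * ?D m) \<longleftrightarrow> P (q * int a)" for q m
    proof (induction m)
      case (Suc m)
      define z where "z = q * int a + 2 * ?D m"
      have z: "[z = int (2 * m * b)] (mod int a)" unfolding z_def by (rule residue)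
      then have "z mod int a = int (2 * m * b mod a)"
        by (simp add: cong_def zmod_int)
      moreover have "(z + int b) mod int a = int ((2 * m + 1) * b mod a)"
        using cong_add[OF z cong_refl[of "int b"]] by (simp add: cong_def zmod_int algebra_simps)
      ultimately have next_z: "q * int a + 2 * ?D (Suc m) = z + 2 * ((z + int b) mod int a - z mod int a)"
        by (simp add: z_def)
      have "P (q * int a + 2 * ?D (Suc m)) \<longleftrightarrow> P z"
        unfolding next_z by (rule double)
      also have "\<dots> \<longleftrightarrow> P (q * int a)"
        unfolding z_def by (rule Suc.IH)
      finally show ?case .
    qed simp
    \<comment> \<open>After \<open>a div 2\<close> double rounds the displacement is twice
      \<open>a div 2\<close>, that is, exactly one block.\<close>
    have next_block: "P ((q + 1) * int a) \<longleftrightarrow> P (q * int a)" for q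
    proof -
      have "2 * ?D (a div 2) = int a"
        using sum_alternating_residues[of a b] a co by (simp add: coprime_iff_gcd_eq_1)
      then show ?thesis using iter[of q "a div 2"] by (simp add: algebra_simps)
    qed
    have multiple: "P (q * int a) \<longleftrightarrow> P 0" for q
    proof (induction q rule: int_induct[where k = 0])
      case (step2 i)
      then show ?case using next_block[of "i - 1"] by simp
    qed (use next_block in simp_all)
    have shift_b: "\<exists>w. [w = z + int j * int b] (mod int a) \<and> (P w \<longleftrightarrow> P z)" for z j
    proof (induction j)
      case 0
      show ?case by (intro exI[of _ z]) simp
    next
      case (Suc j)
      then obtain w where w: "[w = z + int j * int b] (mod int a)" "P w \<longleftrightarrow> P z" by blast
      have "[w + int b - (2 * (w div int a) + 1) * int a = z + int (Suc j) * int b] (mod int a)"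
        using cong_diff[OF cong_add[OF w(1) cong_refl[of "int b"]], of "(2 * (w div int a) + 1) * int a" 0]
        by (simp add: algebra_simps cong_def)
      then show ?case using single[of w] w(2) by blast
    qed
    have all: "P z \<longleftrightarrow> P 0" for z
    proof -
      have "coprime (int b) (int a)" using co by (simp add: coprime_iff_gcd_eq_1 gcd.commute)
      then obtain x where x: "[int b * x = 1] (mod int a)"
        using cong_solve_coprime_int by blast
      \<comment> \<open>Since \<open>x\<close> inverts \<open>b\<close> modulo \<open>a\<close>,
        adding \<open>b\<close> this many times cancels the residue of \<open>z\<close>; the point
        reached is a multiple of \<open>a\<close>, where \<open>multiple\<close> applies.\<close>
      define j where "j = nat ((- z * x) mod int a)"
      have j: "[int j = - z * x] (mod int a)"
        using a by (simp add: j_def cong_def)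
      obtain w where w: "[w = z + int j * int b] (mod int a)" "P w \<longleftrightarrow> P z"
        using shift_b by blast
      note w(1)
      also have "[z + int j * int b = z + (- z * x) * int b] (mod int a)"
        by (intro cong_add cong_mult j cong_refl)
      also have "z + (- z * x) * int b = z + (- z) * (int b * x)" by simp
      also have "[z + (- z) * (int b * x) = z + (- z) * 1] (mod int a)"
        by (intro cong_add cong_mult x cong_refl)
      finally have "int a dvd w" by (simp add: cong_0_iff)
      then obtain q where "w = q * int a" by (metis dvdE mult.commute)
      then show ?thesis using w(2) multiple by simp
    qed
    then show "\<forall>x\<in>{0..<n}. Q x"
      using ex P_nat by (metis atLeastLessThan_iff)
  qed
  have "odd n" using a bodd by (simp add: n_def)
  then obtain h where "n = 2 * h + 1" by (rule oddE)
  then have "\<exists>x\<in>{0..<n}. T x = x \<or> ?B x = x"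
    by (intro bexI[of _ h]) auto
  then show ?thesis using n rT rB tr by (simp add: meander_path_def)
qed

subsection \<open>The seaweed algebra and its index\<close>

lemma coord_span_eq:
  assumes "R \<subseteq> {..<n}"
  shows "coord_span TYPE('k::field) n R = {v \<in> carrier_vec n. \<forall>i<n. i \<notin> R \<longrightarrow> v $ i = 0}"
    (is "_ = ?U")
proof -
  interpret vec_space "TYPE('k)" n .
  have carr: "unit_vec n ` R \<subseteq> carrier_vec n" by auto
  show ?thesis
    unfolding coord_span_def
  proof (intro equalityI subsetI)
    fix v :: "'k vec"
    assume v: "v \<in> span (unit_vec n ` R)"
    then obtain c A where c: "v = lincomb c A" "finite A" "A \<subseteq> unit_vec n ` R"
      using in_spanE by blast
    then have A: "A \<subseteq> carrier_vec n" using carr by blast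
    have "v $ i = 0" if "i < n" "i \<notin> R" for i
    proof -
      have "v $ i = (\<Sum>x\<in>A. c x * x $ i)"
        unfolding c(1) using that A by (intro lincomb_index)
      also have "\<dots> = 0"
      proof (intro sum.neutral ballI)
        fix x assume "x \<in> A"
        then obtain j where "j \<in> R" "x = unit_vec n j" using c(3) by blast
        moreover from this have "j < n" "i \<noteq> j" using assms that by auto
        ultimately show "c x * x $ i = 0" using that by simp
      qed
      finally show ?thesis .
    qed
    moreover have "v \<in> carrier_vec n"
      unfolding c(1) using A by (rule lincomb_closed)
    ultimately show "v \<in> ?U" by simp
  next
    fix v :: "'k vec"
    assume v: "v \<in> ?U"
    have fin: "finite R" using assms finite_subset by blast
    have inj: "inj_on (unit_vec n :: nat \<Rightarrow> 'k vec) R"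
      using assms by (auto simp: inj_on_def)
    \<comment> \<open>The coefficient of a unit vector is the scalar product of \<open>v\<close>
      with it.\<close>
    have "v = lincomb (\<lambda>u. v \<bullet> u) (unit_vec n ` R)"
    proof (rule eq_vecI)
      have d: "lincomb (\<lambda>u. v \<bullet> u) (unit_vec n ` R) \<in> carrier_vec n"
        using carr by (rule lincomb_closed)
      then show "dim_vec v = dim_vec (lincomb (\<lambda>u. v \<bullet> u) (unit_vec n ` R))"
        using v by auto
      fix i assume "i < dim_vec (lincomb (\<lambda>u. v \<bullet> u) (unit_vec n ` R))"
      then have i: "i < n" using d by auto
      have "lincomb (\<lambda>u. v \<bullet> u) (unit_vec n ` R) $ i = (\<Sum>u\<in>unit_vec n ` R. (v \<bullet> u) * u $ i)"
        using i carr by (intro lincomb_index)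
      also have "\<dots> = (\<Sum>r\<in>R. if r = i then v $ i else 0)"
        unfolding sum.reindex[OF inj] o_def
        using assms i by (intro sum.cong) auto
      also have "\<dots> = v $ i"
        using v i fin by auto
      finally show "v $ i = lincomb (\<lambda>u. v \<bullet> u) (unit_vec n ` R) $ i" by simp
    qed
    then show "v \<in> span (unit_vec n ` R)"
      using fin by (intro in_spanI) auto
  qed
qed

lemma preserves_coord_span_iff:
  fixes A :: "'k::field mat"
  assumes A: "A \<in> carrier_mat n n" and R: "R \<subseteq> {..<n}"
  shows "preserves A (coord_span TYPE('k) n R) \<longleftrightarrow> (\<forall>r<n. \<forall>c\<in>R. r \<notin> R \<longrightarrow> A $$ (r, c) = 0)"
proof
  assume pres: "preserves A (coord_span TYPE('k) n R)"
  show "\<forall>r<n. \<forall>c\<in>R. r \<notin> R \<longrightarrow> A $$ (r, c) = 0"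
  proof (intro allI impI ballI)
    fix r c assume rc: "r < n" "c \<in> R" "r \<notin> R"
    then have "c < n" using R by auto
    then have "unit_vec n c \<in> coord_span TYPE('k) n R"
      using rc by (auto simp: coord_span_eq[OF R])
    then have "A *\<^sub>v unit_vec n c \<in> coord_span TYPE('k) n R"
      using pres by (simp add: preserves_def)
    then have "(A *\<^sub>v unit_vec n c) $ r = 0"
      using rc by (simp add: coord_span_eq[OF R])
    then show "A $$ (r, c) = 0"
      using A rc \<open>c < n\<close> by simp
  qed
next
  assume A0: "\<forall>r<n. \<forall>c\<in>R. r \<notin> R \<longrightarrow> A $$ (r, c) = 0"
  show "preserves A (coord_span TYPE('k) n R)"
    unfolding preserves_def coord_span_eq[OF R]
  proof (intro ballI CollectI conjI allI impI)
    fix v :: "'k vec" assume v: "v \<in> {v \<in> carrier_vec n. \<forall>i<n. i \<notin> R \<longrightarrow> v $ i = 0}"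
    then show "A *\<^sub>v v \<in> carrier_vec n" using A by auto
    fix r assume r: "r < n" "r \<notin> R"
    have "(A *\<^sub>v v) $ r = (\<Sum>c = 0..<n. A $$ (r, c) * v $ c)"
      using A v r by (auto simp: scalar_prod_def)
    also have "\<dots> = 0"
      using A0 v r by (intro sum.neutral) auto
    finally show "(A *\<^sub>v v) $ r = 0" .
  qed
qed

section \<open>From a rigid functional to index zero\<close>

lemma dim_trivial_submodule:
  "vectorspace.dim class_ring ((module_mat TYPE('k::field) n m)\<lparr>carrier := {0\<^sub>m n m}\<rparr>) = 0"
proof -
  let ?V = "module_mat TYPE('k) n m"
  interpret V: vectorspace class_ring ?V by (rule matrix_vs)
  let ?W = "?V\<lparr>carrier := {0\<^sub>m n m}\<rparr>"
  have "subspace class_ring {0\<^sub>m n m} ?V"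
    unfolding subspace_def submodule_def
    using V.vectorspace_axioms V.module_axioms by (auto simp: module_mat_simps)
  then interpret W: vectorspace class_ring ?W by (rule V.subspace_is_vs)
  have "W.span {} = carrier ?W"
    by (auto simp: W.span_def W.lincomb_def module_mat_simps)
  then have "\<exists>A. finite A \<and> card A = 0 \<and> A \<subseteq> carrier ?W \<and> W.gen_set A"
    by (intro exI[of _ "{}"]) simp
  then show ?thesis unfolding W.dim_def by (simp add: Least_eq_0)
qed

text \<open>Cyclicity of the trace: tr(F [x, y]) = tr([F, x] y). The condition on \<open>x\<close>
  to lie in the kernel becomes a condition on the entries of [F, x].\<close>

lemma commutator_pairing:
  fixes x y :: "'k::field mat"
  assumes "x \<in> carrier_mat n n" "y \<in> carrier_mat n n"
  shows "(\<Sum>i<n. \<Sum>j<n. F i j * commutator x y $$ (j, i)) =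
    (\<Sum>k<n. \<Sum>i<n. y $$ (k, i) * commutator_entry {0..<n} F (\<lambda>r c. x $$ (r, c)) i k)"
proof -
  let ?x = "\<lambda>r c. x $$ (r, c)" and ?y = "\<lambda>r c. y $$ (r, c)"
  have "(\<Sum>i<n. \<Sum>j<n. F i j * commutator x y $$ (j, i)) =
      (\<Sum>i<n. \<Sum>j<n. \<Sum>k<n. F i j * ?x j k * ?y k i) - (\<Sum>i<n. \<Sum>j<n. \<Sum>k<n. F i j * ?y j k * ?x k i)"
    using assms
    by (simp add: commutator_def scalar_prod_def sum_subtractf sum_distrib_left right_diff_distrib
        lessThan_atLeast0 mult.assoc)
  also have "(\<Sum>i<n. \<Sum>j<n. \<Sum>k<n. F i j * ?x j k * ?y k i) = (\<Sum>k<n. \<Sum>i<n. ?y k i * (\<Sum>j<n. F i j * ?x j k))"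
  proof -
    have "(\<Sum>i<n. \<Sum>j<n. \<Sum>k<n. F i j * ?x j k * ?y k i) = (\<Sum>i<n. \<Sum>k<n. \<Sum>j<n. F i j * ?x j k * ?y k i)"
      by (intro sum.cong refl sum.swap)
    also have "\<dots> = (\<Sum>k<n. \<Sum>i<n. \<Sum>j<n. F i j * ?x j k * ?y k i)"
      by (rule sum.swap)
    finally show ?thesis by (simp add: sum_distrib_left mult_ac)
  qed
  also have "(\<Sum>i<n. \<Sum>j<n. \<Sum>k<n. F i j * ?y j k * ?x k i) = (\<Sum>j<n. \<Sum>k<n. ?y j k * (\<Sum>i<n. ?x k i * F i j))"
  proof -
    have "(\<Sum>i<n. \<Sum>j<n. \<Sum>k<n. F i j * ?y j k * ?x k i) = (\<Sum>j<n. \<Sum>i<n. \<Sum>k<n. F i j * ?y j k * ?x k i)"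
      by (rule sum.swap)
    also have "\<dots> = (\<Sum>j<n. \<Sum>k<n. \<Sum>i<n. F i j * ?y j k * ?x k i)"
      by (intro sum.cong refl sum.swap)
    finally show ?thesis by (simp add: sum_distrib_left mult_ac)
  qed
  finally show ?thesis
    by (simp add: commutator_entry_def right_diff_distrib sum_subtractf lessThan_atLeast0)
qed

text \<open>Let C = [F, x] for \<open>x\<close> in the kernel. Testing with matrix units shows that
  C vanishes at the allowed off-diagonal positions; testing with differences of diagonal units shows
  that its diagonal is constant. Its trace is 0, so in characteristic 0 the diagonal vanishes too.
  Rigidity makes \<open>x\<close> scalar, and trace 0 makes it 0.\<close>

lemma lie_index_zero_if_rigid:
  fixes F :: "nat \<Rightarrow> nat \<Rightarrow> 'k::field_char_0"
  assumes n: "n > 0" and refl: "\<And>i. R i i" and rig: "rigid {0..<n} R F"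
  shows "lie_index ((module_mat TYPE('k) n n)\<lparr>carrier := {A \<in> carrier_mat n n. trace_mat A = 0 \<and>
    (\<forall>r<n. \<forall>c<n. \<not> R r c \<longrightarrow> A $$ (r, c) = 0)}\<rparr>) commutator = 0"
proof -
  define L where "L = (module_mat TYPE('k) n n)\<lparr>carrier := {A \<in> carrier_mat n n. trace_mat A = 0 \<and>
    (\<forall>r<n. \<forall>c<n. \<not> R r c \<longrightarrow> A $$ (r, c) = 0)}\<rparr>"
  have L: "A \<in> carrier L \<longleftrightarrow> A \<in> carrier_mat n n \<and> trace_mat A = 0 \<and>
      (\<forall>r<n. \<forall>c<n. \<not> R r c \<longrightarrow> A $$ (r, c) = 0)" for A
    by (simp add: L_def)
  define f where "f A = (\<Sum>i<n. \<Sum>j<n. F i j * A $$ (j, i))" for A :: "'k mat"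
  have "f \<in> dual_space L"
    unfolding dual_space_def
  proof (intro CollectI conjI ballI allI)
    show "f (x \<oplus>\<^bsub>L\<^esub> y) = f x + f y" if "x \<in> carrier L" "y \<in> carrier L" for x y
    proof -
      have "x \<oplus>\<^bsub>L\<^esub> y = x + y" by (simp add: L_def module_mat_simps)
      moreover have "(x + y) $$ (j, i) = x $$ (j, i) + y $$ (j, i)" if "i < n" "j < n" for i j
        using that \<open>y \<in> carrier L\<close> unfolding L by auto
      ultimately show ?thesis
        by (simp add: f_def sum.distrib distrib_left cong: sum.cong_simp)
    qed
    show "f (c \<odot>\<^bsub>L\<^esub> x) = c * f x" if "x \<in> carrier L" for c x
    proof -
      have "c \<odot>\<^bsub>L\<^esub> x = c \<cdot>\<^sub>m x" by (simp add: L_def module_mat_simps)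
      moreover have "(c \<cdot>\<^sub>m x) $$ (j, i) = c * x $$ (j, i)" if "i < n" "j < n" for i j
        using that \<open>x \<in> carrier L\<close> unfolding L by auto
      ultimately show ?thesis
        by (simp add: f_def sum_distrib_left mult.left_commute cong: sum.cong_simp)
    qed
  qed
  moreover have ker: "bracket_form_kernel L commutator f = {0\<^sub>m n n}"
  proof (intro equalityI subsetI)
    fix x assume x: "x \<in> bracket_form_kernel L commutator f"
    then have xL: "x \<in> carrier_mat n n" "trace_mat x = 0"
        "\<And>r c. r < n \<Longrightarrow> c < n \<Longrightarrow> \<not> R r c \<Longrightarrow> x $$ (r, c) = 0"
      and fx: "\<And>y. y \<in> carrier L \<Longrightarrow> f (commutator x y) = 0"
      by (auto simp: bracket_form_kernel_def L)
    define C where "C = commutator_entry {0..<n} F (\<lambda>r c. x $$ (r, c))"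
    have pairing: "(\<Sum>k<n. \<Sum>i<n. y $$ (k, i) * C i k) = 0" if "y \<in> carrier L" for y
      using fx[OF that] commutator_pairing[OF xL(1), of y F] that by (simp add: f_def C_def L)
    have off: "C i k = 0" if ik: "i < n" "k < n" "i \<noteq> k" "R k i" for i k
    proof -
      define y :: "'k mat" where "y = mat n n (\<lambda>(p, q). if p = k \<and> q = i then 1 else 0)"
      have "y \<in> carrier L"
        using ik by (auto simp: L y_def trace_mat_def intro!: sum.neutral)
      note pairing[OF this]
      moreover have "(\<Sum>p<n. \<Sum>q<n. y $$ (p, q) * C q p) = (\<Sum>p<n. \<Sum>q<n. if p = k \<and> q = i then C i k else 0)"
        by (intro sum.cong refl) (auto simp: y_def)
      moreover have "(\<Sum>q<n. if p = k \<and> q = i then C i k else 0) = (if p = k then C i k else 0)" for p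
        using ik by (cases "p = k") auto
      ultimately show ?thesis using ik by simp
    qed
    have diag: "C i i = C k k" if ik: "i < n" "k < n" for i k
    proof (cases "i = k")
      case False
      define y :: "'k mat" where
        "y = mat n n (\<lambda>(p, q). if p = q then (if p = i then 1 else if p = k then -1 else 0) else 0)"
      have ysum: "(\<Sum>p<n. (if p = i then 1 else if p = k then -1 else 0) * g p) = g i - g k" for g :: "nat \<Rightarrow> 'k"
      proof -
        have "(\<Sum>p<n. (if p = i then 1 else if p = k then -1 else 0) * g p) =
            (\<Sum>p<n. (if p = i then g i else 0) - (if p = k then g k else 0))"
          using False by (intro sum.cong) auto
        then show ?thesis using ik by (simp add: sum_subtractf)
      qed
      have "trace_mat y = 0"
        using ysum[of "\<lambda>_. 1"] by (simp add: trace_mat_def y_def)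
      then have "y \<in> carrier L"
        using refl by (auto simp: L y_def)
      from pairing[OF this] have "(\<Sum>p<n. (if p = i then 1 else if p = k then -1 else 0) * C p p) = 0"
      proof -
        have "(\<Sum>q<n. y $$ (p, q) * C q p) = (if p = i then 1 else if p = k then -1 else 0) * C p p"
          if "p < n" for p
        proof -
          have "(\<Sum>q<n. y $$ (p, q) * C q p) =
              (\<Sum>q<n. if q = p then (if p = i then 1 else if p = k then -1 else 0) * C p p else 0)"
            using that by (intro sum.cong) (auto simp: y_def)
          then show ?thesis using that by simp
        qed
        then show ?thesis using \<open>(\<Sum>k<n. \<Sum>i<n. y $$ (k, i) * C i k) = 0\<close> by simp
      qed
      then have "C i i - C k k = 0" by (simp only: ysum[of "\<lambda>p. C p p"])
      then show ?thesis by simp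
    qed simp
    have "(\<Sum>i<n. C i i) = 0"
    proof -
      have "(\<Sum>i<n. \<Sum>j<n. F i j * x $$ (j, i)) = (\<Sum>j<n. \<Sum>i<n. F i j * x $$ (j, i))"
        by (rule sum.swap)
      also have "\<dots> = (\<Sum>j<n. \<Sum>i<n. x $$ (j, i) * F i j)"
        by (simp only: mult.commute)
      finally show ?thesis
        by (simp only: C_def commutator_entry_def sum_subtractf atLeast0LessThan) simp
    qed
    moreover have "(\<Sum>i<n. C i i) = of_nat n * C 0 0"
    proof -
      have "(\<Sum>i<n. C i i) = (\<Sum>i<n. C 0 0)"
        using n by (intro sum.cong refl diag) auto
      then show ?thesis by simp
    qed
    ultimately have "C 0 0 = 0" using n by simp
    then have "C i i = 0" if "i < n" for i
      using diag[of i 0] that n by metis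
    then have "commutator_entry {0..<n} F (\<lambda>r c. x $$ (r, c)) i j = 0"
      if "i \<in> {0..<n}" "j \<in> {0..<n}" "R j i" for i j
      using off[of i j] that by (cases "i = j") (auto simp: C_def)
    then have "\<exists>c. \<forall>i\<in>{0..<n}. \<forall>j\<in>{0..<n}. x $$ (i, j) = (if i = j then c else 0)"
      using xL(3) by (intro rigid_scalar[OF rig]) auto
    then obtain c where c: "\<And>i j. i < n \<Longrightarrow> j < n \<Longrightarrow> x $$ (i, j) = (if i = j then c else 0)"
      by auto
    have "trace_mat x = of_nat n * c"
      using xL(1) c by (simp add: trace_mat_def)
    then have "c = 0" using xL(2) n by simp
    then show "x \<in> {0\<^sub>m n n}"
      using c xL(1) by (auto intro!: eq_matI)
  next
    fix x :: "'k mat"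
    assume "x \<in> {0\<^sub>m n n}"
    then show "x \<in> bracket_form_kernel L commutator f"
      by (auto simp: bracket_form_kernel_def L trace_mat_def f_def commutator_def)
  qed
  moreover have "vectorspace.dim class_ring (L\<lparr>carrier := {0\<^sub>m n n}\<rparr>) = 0"
    using dim_trivial_submodule[of n n, where 'k = 'k] by (simp add: L_def)
  ultimately have "\<exists>f\<in>dual_space L. 0 = vectorspace.dim class_ring (L\<lparr>carrier := bracket_form_kernel L commutator f\<rparr>)"
    by (metis (no_types))
  then have "lie_index L commutator = 0"
    unfolding lie_index_def by (rule Least_eq_0)
  then show ?thesis by (simp add: L_def)
qed

text \<open>The last top prefix spans the whole space and the bottom subspace is zero, so only the
  first \<open>k\<close> prefixes impose conditions.\<close>

lemma seaweed_blocks: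
  fixes a b k :: nat
  assumes "a > 0"
  defines "n \<equiv> k * a + b"
  shows "seaweed TYPE('k::field) (replicate k a @ [b]) [n] =
    (module_mat TYPE('k) n n)\<lparr>carrier := {A \<in> carrier_mat n n. trace_mat A = 0 \<and>
      (\<forall>r<n. \<forall>c<n. \<not> seaweed_rel (\<lambda>x. min (x div a) k) (\<lambda>_. 0) r c \<longrightarrow> A $$ (r, c) = 0)}\<rparr>"
proof -
  let ?as = "replicate k a @ [b]"
  have sum: "sum_list ?as = n" by (simp add: n_def sum_list_replicate)
  have le: "k * a \<le> n" by (simp add: n_def)
  have top: "(\<forall>i\<in>{1..length ?as}. preserves A (coord_span TYPE('k) n {..<sum_list (take i ?as)})) \<longleftrightarrow>
      (\<forall>r<n. \<forall>c<n. \<not> seaweed_rel (\<lambda>x. min (x div a) k) (\<lambda>_. 0) r c \<longrightarrow> A $$ (r, c) = 0)"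
    if A: "A \<in> carrier_mat n n" for A :: "'k mat"
  proof -
    have prefix: "sum_list (take i ?as) = i * a" "i * a \<le> n" if "i \<le> k" for i
      using that order.trans[OF mult_le_mono1[OF that] le] by (simp_all add: sum_list_replicate min_def)
    show ?thesis
    proof (intro iffI allI impI ballI)
      fix r c
      assume pres: "\<forall>i\<in>{1..length ?as}. preserves A (coord_span TYPE('k) n {..<sum_list (take i ?as)})"
        and rc: "r < n" "c < n" "\<not> seaweed_rel (\<lambda>x. min (x div a) k) (\<lambda>_. 0) r c"
      \<comment> \<open>The rank of \<open>r\<close> gives a prefix that contains \<open>c\<close>
        but not \<open>r\<close>, since the rank of \<open>c\<close> is smaller.\<close>
      define i where "i = min (r div a) k"
      have i: "min (c div a) k < i" "i \<le> k" "i \<le> r div a"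
        using rc by (auto simp: seaweed_rel_def i_def)
      then have "c div a < i" by auto
      then have "c < i * a" "i * a \<le> r"
        using i assms by (simp_all add: div_less_iff_less_mult less_eq_div_iff_mult_less_eq)
      moreover have "preserves A (coord_span TYPE('k) n {..<i * a})"
        using bspec[OF pres, of i] i prefix(1)[OF i(2)] by simp
      ultimately show "A $$ (r, c) = 0"
        using preserves_coord_span_iff[OF A, of "{..<i * a}"] prefix(2)[of i] i(2) rc by auto
    next
      fix i
      assume A0: "\<forall>r<n. \<forall>c<n. \<not> seaweed_rel (\<lambda>x. min (x div a) k) (\<lambda>_. 0) r c \<longrightarrow> A $$ (r, c) = 0"
        and i: "i \<in> {1..length ?as}"
      show "preserves A (coord_span TYPE('k) n {..<sum_list (take i ?as)})"
      proof (cases "i \<le> k")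
        case True
        have "A $$ (r, c) = 0" if "r < n" "c < i * a" "i * a \<le> r" for r c
        proof -
          have "c div a < i" "i \<le> r div a"
            using that assms by (simp_all add: div_less_iff_less_mult less_eq_div_iff_mult_less_eq)
          then show ?thesis using A0 that prefix(2)[OF True] True by (auto simp: seaweed_rel_def)
        qed
        then show ?thesis
          using preserves_coord_span_iff[OF A, of "{..<i * a}"] prefix[OF True] by auto
      next
        case False
        then have "sum_list (take i ?as) = n" using i sum by simp
        then show ?thesis by (simp add: preserves_coord_span_iff[OF A])
      qed
    qed
  qed
  have bottom: "(\<forall>j\<in>{1..length [n]}. preserves A (coord_span TYPE('k) n {sum_list (take j [n])..<n}))"
    if A: "A \<in> carrier_mat n n" for A :: "'k mat"
    using preserves_coord_span_iff[OF A, of "{}"] by auto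
  show ?thesis
    unfolding seaweed_def Let_def sum using top bottom by (intro arg_cong[of _ _ "\<lambda>X. module_mat TYPE('k) n n\<lparr>carrier := X\<rparr>"]) blast
qed

theorem theorem7:
  fixes a b k :: nat
  assumes "a > 0" and "b > 0" and "even a" and "gcd a b = 1" and "k \<ge> 1"
  shows "frobenius_meander TYPE('k::field_char_0) (replicate k a @ [b]) [k * a + b]"
proof -
  let ?R = "seaweed_rel (\<lambda>x. min (x div a) k) (\<lambda>_. 0)"
  obtain F :: "nat \<Rightarrow> nat \<Rightarrow> 'k" where "rigid {0..<k * a + b} ?R F"
    using meander_path_rigid[OF meander_path_blocks[OF assms(1,3,2,4,5)]] by blast
  moreover have "?R i i" for i
    by (simp add: seaweed_rel_def)
  ultimately show ?thesis
    unfolding frobenius_meander_def meander_index_def seaweed_blocks[OF assms(1)]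
    using assms(2) by (intro lie_index_zero_if_rigid) auto
qed

end
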